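(* Let $\mathbb{k}$ be a field of prime characteristic $p$ such that $R=\mathbb{k}[x_1,\ldots,x_m]$ is $F$-finite, and let $\mathfrak{m}=(x_1,\ldots,x_m)$. Let $\boldsymbol{f}=(f_1,\ldots,f_t)$ be a polynomial mapping of elements $f_i\in\mathfrak{m}$. Suppose that the splitting polytope $\mathcal{P}_{\boldsymbol{f}}$ has a unique maximal point $\rho=(\rho_1,\ldots,\rho_t)$ with $\rho_i=(\rho_{i,1},\ldots,\rho_{i,l_i})\in\mathbb{R}^{l_i}$, and set for $i\in\{1,\ldots,t\}$ $$S_i=\sup\Big\{\ell\in\mathbb{Z}_{\geq 0}\ \Big|\ \sum_{j=1}^{l_i}\rho_{i,j}^{(e)}\leq p-1\ \text{ for every } 0\leq e\leq \ell\Big\}.$$ Let $I$ be the set of indices $i$ for which $S_i$ is finite. Then $$\prod_{i\in I}\left(|\langle\rho_i\rangle_{S_i}|+\frac{1}{p^{S_i}}\right)\prod_{i\notin I}|\rho_i|\ \leq\ \operatorname{Vol}_F^{\mathfrak{m}}((f_1),\ldots,(f_t)).$$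
   Context: $R$ is $F$-finite if its Frobenius map is finite. **$F$-volume.** For ideals $\mathfrak{a}_1,\ldots,\mathfrak{a}_t,\mathfrak{b}$ of $R$ with $\mathfrak{a}_i\subseteq\sqrt{\mathfrak{b}}$ for all $i$, let $\mathfrak{b}^{[p^e]}$ be the ideal generated by the $p^e$-th powers of elements of $\mathfrak{b}$ and $$V^{\mathfrak{b}}_{\mathfrak{a}_1,\ldots,\mathfrak{a}_t}(p^e)=\{(n_1,\ldots,n_t)\in\mathbb{Z}_{\ge0}^t\mid\mathfrak{a}_1^{n_1}\cdots\mathfrak{a}_t^{n_t}\not\subseteq\mathfrak{b}^{[p^e]}\}.$$ The $F$-volume is $\operatorname{Vol}_F^{\mathfrak{b}}(\mathfrak{a}_1,\ldots,\mathfrak{a}_t)=\lim_{e\to\infty}p^{-et}\operatorname{Card}\big(V^{\mathfrak{b}}_{\mathfrak{a}_1,\ldots,\mathfrak{a}_t}(p^e)\big)$ (the limit is known to exist). **$p$-expansions.** Every $\alpha\in(0,1]$ is written uniquely as $\alpha=\sum_{k\ge1}\alpha^{(k)}/p^k$ with integers $0\le\alpha^{(k)}\le p-1$ such that the sequence $(\alpha^{(k)})_{k\ge1}$ is not eventually $0$ (nonterminating expansion). Put $\langle\alpha\rangle_e=\sum_{k=1}^e\alpha^{(k)}/p^k$, $\alpha^{(0)}=\langle\alpha\rangle_0=0$, $\langle\alpha\rangle_\infty=\alpha$; for $\alpha=0$ all digits and truncations are $0$. For a vector $\alpha\in[0,1]^l$, $\langle\alpha\rangle_e$ is taken entrywise,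 and for $\alpha\in\mathbb{R}^l$, $|\alpha|$ is the sum of the entries of $\alpha$. **Splitting polytope.** For a polynomial $f=\sum_a c_a x^a$, $\operatorname{Supp}(f)=\{a\in\mathbb{Z}_{\ge0}^m\mid c_a\neq0\}$. Let $\boldsymbol{f}=(f_1,\ldots,f_t)$ with $f_i\in\mathfrak{m}$. Put $\hat f_1=f_1$ and, for $i\ge2$, let $\hat f_i$ be obtained from $f_i$ by removing all terms whose monomial already appears (with any nonzero coefficient) in one of $f_1,\ldots,f_{i-1}$. Let $l_i=\operatorname{Card}(\operatorname{Supp}(\hat f_i))$, $N=l_1+\cdots+l_t$, and let $\widehat{\mathcal{E}}_i$ be the $m\times l_i$ matrix whose columns are the elements of $\operatorname{Supp}(\hat f_i)$. The exponent matrix is $\mathcal{E}_{\boldsymbol{f}}=(\widehat{\mathcal{E}}_1\mid\cdots\mid\widehat{\mathcal{E}}_t)$ (size $m\times N$). If $l_i=0$, then $f_i$ contributes no columns (the $i$-th block is empty, $|\rho_i|=0$). With $\preceq$ the componentwise order and $\mathbf{1}_m=(1,\ldots,1)\in\mathbb{R}^m$, the splitting polytope is $$\mathcal{P}_{\boldsymbol{f}}=\{\gamma\in\mathbb{R}_{\ge0}^N\mid \mathcal{E}_{\boldsymbol{f}}\cdot\gamma\preceq\mathbf{1}_m\}\subseteq[0,1]^N.$$ A maximal point of $\mathcal{P}_{\boldsymbol{f}}$ is a point at which $\gamma\mapsto|\gamma|$ attains its maximum on $\mathcal{P}_{\boldsymbol{f}}$. Points of $\mathcal{P}_{\boldsymbol{f}}$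 are written in blocks according to $\mathbb{R}^N=\mathbb{R}^{l_1}\times\cdots\times\mathbb{R}^{l_t}$. *)

theory Defs
  imports Complex_Main "HOL-Library.Poly_Mapping" "HOL-Library.Extended_Nat"
    "HOL-Library.FuncSet" "HOL-Computational_Algebra.Primes"
begin

definition ideal_gen :: "'a::comm_ring_1 set \<Rightarrow> 'a set" where
  "ideal_gen S = module.span (*) S"

definition ideal_mult :: "'a::comm_ring_1 set \<Rightarrow> 'a set \<Rightarrow> 'a set" where
  "ideal_mult I J = ideal_gen {x * y | x y. x \<in> I \<and> y \<in> J}"

primrec ideal_pow :: "'a::comm_ring_1 set \<Rightarrow> nat \<Rightarrow> 'a set" where
  "ideal_pow I 0 = UNIV"
| "ideal_pow I (Suc n) = ideal_mult (ideal_pow I n) I"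

primrec ideal_prod :: "(nat \<Rightarrow> 'a::comm_ring_1 set) \<Rightarrow> nat \<Rightarrow> 'a set" where
  "ideal_prod I 0 = UNIV"
| "ideal_prod I (Suc t) = ideal_mult (ideal_prod I t) (I (Suc t))"

text \<open>For an ideal \<open>b\<close> and \<open>q = p ^ e\<close> this is the \<open>e\<close>-th Frobenius power of \<open>b\<close>.\<close>

definition frobenius_power :: "'a::comm_ring_1 set \<Rightarrow> nat \<Rightarrow> 'a set" where
  "frobenius_power b q = ideal_gen ((\<lambda>x. x ^ q) ` b)"

definition finite_ring_hom :: "('a::comm_ring_1 \<Rightarrow> 'b::comm_ring_1) \<Rightarrow> bool" where
  "finite_ring_hom \<phi> \<longleftrightarrow> (\<exists>B. finite B \<and> module.span (\<lambda>a b. \<phi> a * b) B = UNIV)"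

definition F_finite :: "'a::comm_ring_1 itself \<Rightarrow> bool" where
  "F_finite _ \<longleftrightarrow> finite_ring_hom (\<lambda>x::'a. x ^ CHAR('a))"

text \<open>Exponent vectors \<open>(n\<^sub>1, \<dots>, n\<^sub>t)\<close> are extensional functions on \<open>{1..t}\<close>.\<close>

definition V_set :: "nat \<Rightarrow> (nat \<Rightarrow> 'a::comm_ring_1 set) \<Rightarrow> 'a set \<Rightarrow> nat \<Rightarrow> (nat \<Rightarrow> nat) set" where
  "V_set t a b q =
     {n \<in> {1..t} \<rightarrow>\<^sub>E UNIV. \<not> ideal_prod (\<lambda>i. ideal_pow (a i) (n i)) t \<subseteq> frobenius_power b q}"

text \<open>This is meaningful for F-finite Noetherian rings of characteristic \<open>p\<close> and ideals
  \<open>a i\<close> contained in the radical of \<open>b\<close>: then every \<open>V_set\<close> is finite and the limit exists.\<close>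

definition F_volume :: "nat \<Rightarrow> nat \<Rightarrow> (nat \<Rightarrow> 'a::comm_ring_1 set) \<Rightarrow> 'a set \<Rightarrow> real" where
  "F_volume p t a b = lim (\<lambda>e. real (card (V_set t a b (p ^ e))) / real p ^ (e * t))"

definition nonterminating_expansion :: "nat \<Rightarrow> real \<Rightarrow> (nat \<Rightarrow> nat) \<Rightarrow> bool" where
  "nonterminating_expansion p \<alpha> d \<longleftrightarrow>
     d 0 = 0 \<and> (\<forall>k\<ge>1. d k \<le> p - 1) \<and> \<not> (\<forall>\<^sub>F k in sequentially. d k = 0) \<and>
     (\<lambda>k. real (d (Suc k)) / real p ^ Suc k) sums \<alpha>"

text \<open>Intended for \<open>\<alpha> \<in> [0, 1]\<close> and \<open>p \<ge> 2\<close>.\<close>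

definition digit :: "nat \<Rightarrow> real \<Rightarrow> nat \<Rightarrow> nat" where
  "digit p \<alpha> = (if \<alpha> = 0 then (\<lambda>_. 0) else (THE d. nonterminating_expansion p \<alpha> d))"

definition truncation :: "nat \<Rightarrow> nat \<Rightarrow> real \<Rightarrow> real" where
  "truncation p e \<alpha> = (\<Sum>k=1..e. real (digit p \<alpha> k) / real p ^ k)"

text \<open>Polynomials over \<open>'k\<close> in the variables \<open>x\<^sub>r\<close> with \<open>r :: 'm\<close>, as finitely supported maps
  from exponent vectors to coefficients; the support of \<open>f\<close> is \<open>Poly_Mapping.keys f\<close>.\<close>

type_synonym ('m, 'k) mpoly = "('m \<Rightarrow>\<^sub>0 nat) \<Rightarrow>\<^sub>0 'k"

definition variable :: "'m \<Rightarrow> ('m, 'k::comm_ring_1) mpoly" where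
  "variable r = Poly_Mapping.single (Poly_Mapping.single r 1) 1"

definition irrelevant_ideal :: "('m, 'k::comm_ring_1) mpoly set" where
  "irrelevant_ideal = ideal_gen (range variable)"

definition hat :: "(nat \<Rightarrow> ('m, 'k::comm_ring_1) mpoly) \<Rightarrow> nat \<Rightarrow> ('m, 'k) mpoly" where
  "hat f i = (\<Sum>a \<in> Poly_Mapping.keys (f i) - (\<Union>j\<in>{1..<i}. Poly_Mapping.keys (f j)).
                Poly_Mapping.single a (Poly_Mapping.lookup (f i) a))"

abbreviation hat_supp :: "(nat \<Rightarrow> ('m, 'k::comm_ring_1) mpoly) \<Rightarrow> nat \<Rightarrow> ('m \<Rightarrow>\<^sub>0 nat) set" where
  "hat_supp f i \<equiv> Poly_Mapping.keys (hat f i)"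

text \<open>The columns of the exponent matrix are indexed by pairs of a block number \<open>i\<close> and an
  element \<open>a\<close> of the support of \<open>hat f i\<close>, instead of by \<open>1, \<dots>, N\<close>; the column with index
  \<open>(i, a)\<close> is \<open>a\<close>. This leaves the ordering of the columns inside a block, which is
  arbitrary, unspecified. Vectors with \<open>N\<close> entries are extensional functions on this
  index set.\<close>

definition columns :: "nat \<Rightarrow> (nat \<Rightarrow> ('m, 'k::comm_ring_1) mpoly) \<Rightarrow> (nat \<times> ('m \<Rightarrow>\<^sub>0 nat)) set" where
  "columns t f = (SIGMA i:{1..t}. hat_supp f i)"

definition exponent_matrix :: "'m \<Rightarrow> nat \<times> ('m \<Rightarrow>\<^sub>0 nat) \<Rightarrow> nat" where
  "exponent_matrix r c = Poly_Mapping.lookup (snd c) r"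

definition splitting_polytope ::
  "nat \<Rightarrow> (nat \<Rightarrow> ('m, 'k::comm_ring_1) mpoly) \<Rightarrow> (nat \<times> ('m \<Rightarrow>\<^sub>0 nat) \<Rightarrow> real) set" where
  "splitting_polytope t f =
     {\<gamma> \<in> columns t f \<rightarrow>\<^sub>E {0..}. \<forall>r. (\<Sum>c\<in>columns t f. real (exponent_matrix r c) * \<gamma> c) \<le> 1}"

definition maximal_point ::
  "nat \<Rightarrow> (nat \<Rightarrow> ('m, 'k::comm_ring_1) mpoly) \<Rightarrow> (nat \<times> ('m \<Rightarrow>\<^sub>0 nat) \<Rightarrow> real) \<Rightarrow> bool" where
  "maximal_point t f \<gamma> \<longleftrightarrow>
     is_arg_max (\<lambda>\<gamma>. \<Sum>c\<in>columns t f. \<gamma> c) (\<lambda>\<gamma>. \<gamma> \<in> splitting_polytope t f) \<gamma>"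

end

theory Submission
  imports Defs
begin

text \<open>
  Write \<open>q = p ^ e\<close> and let \<open>V(q)\<close> be the set of exponent vectors \<open>n\<close> such that
  \<open>f\<^sub>1 ^ n\<^sub>1 \<cdots> f\<^sub>t ^ n\<^sub>t\<close> lies outside the Frobenius power of level \<open>q\<close>. Two properties of \<open>V(q)\<close>
  reduce the theorem to the construction of one good vector \<open>n\<close> for every \<open>e\<close>. It is closed
  under passing to smaller vectors, so \<open>n \<in> V(q)\<close> forces at least \<open>\<Prod>i. (n\<^sub>i + 1)\<close> elements. And
  since \<open>u \<mapsto> u ^ p\<close> is a ring homomorphism, \<open>n \<in> V(q p)\<close> implies \<open>n div p \<in> V(q)\<close>; hence
  \<open>card V(q p) \<le> p ^ t * card V(q)\<close>, the normalized cardinalities decrease to the volume, and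
  lower bounds valid at every level survive in the limit (\<open>F_volume_principal_ge\<close>).

  The good vector comes from an integral vector \<open>\<alpha>\<close>, indexed by the columns of the exponent
  matrix, with \<open>\<alpha> / q\<close> below the maximal point \<open>\<rho>\<close>, strictly wherever \<open>\<rho>\<close> is positive. Let \<open>n\<^sub>i\<close> be
  the sum of its \<open>i\<close>-th block. The monomial with exponent \<open>E \<alpha>\<close>, where \<open>E\<close> is the exponent matrix,
  is not in the Frobenius power, because all entries of \<open>E \<alpha>\<close> are smaller than \<open>q\<close>. Its
  coefficient in \<open>f\<^sub>1 ^ n\<^sub>1 \<cdots> f\<^sub>t ^ n\<^sub>t\<close> is a sum over all ways of writing \<open>E \<alpha>\<close> by exponents of the
  \<open>f\<^sub>i\<close>. Replacing \<open>\<alpha>\<close> by another such vector \<open>\<gamma>\<close> moves \<open>\<rho>\<close> to \<open>\<rho> + (\<gamma> - \<alpha>) / q\<close>, again a maximal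
  point, so the uniqueness of \<open>\<rho>\<close> leaves only \<open>\<gamma> = \<alpha>\<close> (\<open>unique_preimage_of_exponent\<close>). The
  coefficient is therefore a product of powers of coefficients of the \<open>f\<^sub>i\<close> and of one
  multinomial coefficient per block, which is prime to \<open>p\<close> as soon as the entries of the block
  add up without carries in base \<open>p\<close> (\<open>not_dvd_multinomial_carry_free\<close>).

  It remains to choose \<open>\<alpha>\<close> block by block, without carries and as large as possible. If no
  position of the digits of \<open>\<rho>\<^sub>i\<close> carries, the truncations of \<open>\<rho>\<^sub>i\<close> serve, and \<open>(n\<^sub>i + 1) / q\<close> tends to
  \<open>|\<rho>\<^sub>i|\<close>. If position \<open>S\<^sub>i + 1\<close> is the first one to carry, the digits after \<open>S\<^sub>i\<close> can be chosen so
  that they sum to \<open>p - 1\<close> in every position, and \<open>(n\<^sub>i + 1) / q\<close> is eventually equal to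
  \<open>|\<langle>\<rho>\<^sub>i\<rangle>| + 1 / p ^ S\<^sub>i\<close>, with the truncation taken at \<open>S\<^sub>i\<close> (\<open>carry_free_below_at_carry\<close>).
\<close>

section \<open>Principal ideals and Frobenius powers\<close>

text \<open>A ring is a module over itself whose submodules are the ideals, so generated ideals
  inherit the theory of spans.\<close>

lemma module_ring: "module ((*) :: 'a::comm_ring_1 \<Rightarrow> 'a \<Rightarrow> 'a)"
  by unfold_locales (simp_all add: algebra_simps)

abbreviation is_ideal :: "'a::comm_ring_1 set \<Rightarrow> bool" where
  "is_ideal \<equiv> module.subspace (*)"

lemmas ideal_gen_base = module.span_base[OF module_ring, folded ideal_gen_def]
lemmas ideal_gen_least = module.span_minimal[OF module_ring, folded ideal_gen_def]
lemmas is_ideal_gen = module.subspace_span[OF module_ring, folded ideal_gen_def]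
lemmas is_ideal_def = module.subspace_def[OF module_ring]
lemmas ideal_mult_left = module.subspace_scale[OF module_ring]

lemma principal_ideal: "ideal_gen {x} = range (\<lambda>r. r * x)"
  unfolding ideal_gen_def by (rule module.span_singleton[OF module_ring])

lemma UNIV_eq_ideal_gen_one: "UNIV = ideal_gen {1 :: 'a::comm_ring_1}"
  by (simp add: principal_ideal)

lemma ideal_mult_principal:
  "ideal_mult (ideal_gen {x}) (ideal_gen {y}) = ideal_gen {x * y :: 'a::comm_ring_1}"
proof
  show "ideal_mult (ideal_gen {x}) (ideal_gen {y}) \<subseteq> ideal_gen {x * y}"
    unfolding ideal_mult_def
  proof (rule ideal_gen_least)
    show "{u * v |u v. u \<in> ideal_gen {x} \<and> v \<in> ideal_gen {y}} \<subseteq> ideal_gen {x * y}"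
    proof clarify
      fix u v assume "u \<in> ideal_gen {x}" "v \<in> ideal_gen {y}"
      then obtain r s where "u = r * x" "v = s * y" by (auto simp: principal_ideal)
      hence "u * v = (r * s) * (x * y)" by (simp add: algebra_simps)
      thus "u * v \<in> ideal_gen {x * y}" by (auto simp: principal_ideal)
    qed
    show "is_ideal (ideal_gen {x * y})" by (rule is_ideal_gen)
  qed
  have "x * y \<in> {u * v |u v. u \<in> ideal_gen {x} \<and> v \<in> ideal_gen {y}}"
    using ideal_gen_base[of x "{x}"] ideal_gen_base[of y "{y}"] by auto
  hence "{x * y} \<subseteq> ideal_mult (ideal_gen {x}) (ideal_gen {y})"
    unfolding ideal_mult_def by (blast intro: ideal_gen_base)
  thus "ideal_gen {x * y} \<subseteq> ideal_mult (ideal_gen {x}) (ideal_gen {y})"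
    by (rule ideal_gen_least) (simp add: ideal_mult_def is_ideal_gen)
qed

lemma ideal_pow_principal: "ideal_pow (ideal_gen {x}) n = ideal_gen {x ^ n}"
  by (induction n) (simp_all add: UNIV_eq_ideal_gen_one ideal_mult_principal mult.commute)

lemma ideal_prod_principal:
  "ideal_prod (\<lambda>i. ideal_gen {g i}) t = ideal_gen {\<Prod>i\<in>{1..t}. g i}"
  by (induction t) (simp_all add: UNIV_eq_ideal_gen_one ideal_mult_principal mult.commute)

lemma is_ideal_frobenius_power: "is_ideal (frobenius_power b q)"
  by (simp add: frobenius_power_def is_ideal_gen)

lemma V_set_principal:
  "V_set t (\<lambda>i. ideal_gen {f i}) b q =
     {n \<in> {1..t} \<rightarrow>\<^sub>E UNIV. (\<Prod>i\<in>{1..t}. f i ^ n i) \<notin> frobenius_power b q}"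
proof -
  have "ideal_gen {x} \<subseteq> frobenius_power b q \<longleftrightarrow> x \<in> frobenius_power b q" for x :: 'a
    using ideal_gen_base[of x "{x}"] ideal_gen_least[OF _ is_ideal_frobenius_power, of "{x}" b q]
    by auto
  thus ?thesis by (simp add: V_set_def ideal_pow_principal ideal_prod_principal)
qed

text \<open>In characteristic \<open>p\<close> the map \<open>x \<mapsto> x ^ p\<close> is a ring homomorphism, so it is enough
  to look at the generators \<open>x ^ q\<close> of the Frobenius power.\<close>

lemma power_CHAR_in_frobenius_power:
  fixes u :: "'a::comm_ring_1"
  assumes "prime CHAR('a)" and "u \<in> frobenius_power b q"
  shows "u ^ CHAR('a) \<in> frobenius_power b (q * CHAR('a))"
proof -
  let ?p = "CHAR('a)" let ?J = "frobenius_power b (q * ?p)"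
  have "is_ideal {u. u ^ ?p \<in> ?J}"
    using is_ideal_frobenius_power[of b "q * ?p"] prime_gt_0_nat[OF assms(1)]
    by (auto simp: is_ideal_def freshmans_dream[OF assms(1)] power_mult_distrib power_0_left)
  moreover have "(\<lambda>x. x ^ q) ` b \<subseteq> {u. u ^ ?p \<in> ?J}"
    by (auto simp: frobenius_power_def simp flip: power_mult intro: ideal_gen_base)
  ultimately have "frobenius_power b q \<subseteq> {u. u ^ ?p \<in> ?J}"
    unfolding frobenius_power_def[of b q] by (intro ideal_gen_least)
  with assms(2) show ?thesis by auto
qed

lemma prod_power_in_frobenius_power_mono:
  fixes f :: "nat \<Rightarrow> 'a::comm_ring_1"
  assumes "(\<Prod>i\<in>{1..t}. f i ^ n i) \<in> frobenius_power b q" and "\<And>i. i \<in> {1..t} \<Longrightarrow> n i \<le> n' i"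
  shows "(\<Prod>i\<in>{1..t}. f i ^ n' i) \<in> frobenius_power b q"
proof -
  have "(\<Prod>i\<in>{1..t}. f i ^ n' i) = (\<Prod>i\<in>{1..t}. f i ^ (n' i - n i)) * (\<Prod>i\<in>{1..t}. f i ^ n i)"
    using assms(2) by (simp flip: prod.distrib power_add)
  with assms(1) show ?thesis
    by (simp add: ideal_mult_left[OF is_ideal_frobenius_power])
qed

section \<open>The volume of principal ideals as a decreasing limit\<close>

text \<open>If the quotients gave a product in the Frobenius power of level \<open>q\<close>, its \<open>p\<close>-th power
  would lie in the one of level \<open>q * p\<close>; and \<open>n\<close> is at least \<open>p\<close> times its quotients.\<close>

lemma V_set_div:
  fixes f :: "nat \<Rightarrow> 'a::comm_ring_1"
  assumes p: "prime CHAR('a)" "p = CHAR('a)"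
    and n: "n \<in> V_set t (\<lambda>i. ideal_gen {f i}) b (q * p)"
  shows "restrict (\<lambda>i. n i div p) {1..t} \<in> V_set t (\<lambda>i. ideal_gen {f i}) b q"
proof -
  have "(\<Prod>i\<in>{1..t}. f i ^ (n i div p)) \<notin> frobenius_power b q"
  proof
    assume "(\<Prod>i\<in>{1..t}. f i ^ (n i div p)) \<in> frobenius_power b q"
    hence "(\<Prod>i\<in>{1..t}. f i ^ (n i div p)) ^ p \<in> frobenius_power b (q * p)"
      using p power_CHAR_in_frobenius_power by auto
    hence "(\<Prod>i\<in>{1..t}. f i ^ (n i div p * p)) \<in> frobenius_power b (q * p)"
      by (simp add: power_mult flip: prod_power_distrib)
    hence "(\<Prod>i\<in>{1..t}. f i ^ n i) \<in> frobenius_power b (q * p)"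
      by (rule prod_power_in_frobenius_power_mono) simp
    with n show False by (simp add: V_set_principal)
  qed
  moreover have "(\<Prod>i\<in>{1..t}. f i ^ restrict (\<lambda>i. n i div p) {1..t} i)
      = (\<Prod>i\<in>{1..t}. f i ^ (n i div p))"
    by (rule prod.cong) auto
  ultimately show ?thesis by (simp add: V_set_principal)
qed

text \<open>A vector is determined by its quotients and its remainders modulo \<open>p\<close>. The quotients
  range over the set of level \<open>q\<close>, and there are \<open>p ^ t\<close> vectors of remainders.\<close>

lemma V_set_mult_CHAR:
  fixes f :: "nat \<Rightarrow> 'a::comm_ring_1"
  assumes p: "prime CHAR('a)" "p = CHAR('a)"
    and fin: "finite (V_set t (\<lambda>i. ideal_gen {f i}) b q)"
  shows "finite (V_set t (\<lambda>i. ideal_gen {f i}) b (q * p)) \<and>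
    card (V_set t (\<lambda>i. ideal_gen {f i}) b (q * p))
      \<le> p ^ t * card (V_set t (\<lambda>i. ideal_gen {f i}) b q)"
proof -
  let ?V = "V_set t (\<lambda>i. ideal_gen {f i}) b q"
  let ?W = "V_set t (\<lambda>i. ideal_gen {f i}) b (q * p)"
  let ?B = "{1..t} \<rightarrow>\<^sub>E {..<p}"
  let ?h = "\<lambda>n :: nat \<Rightarrow> nat. (restrict (\<lambda>i. n i div p) {1..t}, restrict (\<lambda>i. n i mod p) {1..t})"
  have p0: "p > 0" using p prime_gt_0_nat by auto
  have inj: "inj_on ?h ?W"
  proof (rule inj_onI)
    fix n n' assume nn: "n \<in> ?W" "n' \<in> ?W" and eq: "?h n = ?h n'"
    show "n = n'"
    proof
      fix i show "n i = n' i"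
      proof (cases "i \<in> {1..t}")
        case True
        have "restrict (\<lambda>i. n i div p) {1..t} = restrict (\<lambda>i. n' i div p) {1..t}"
          and "restrict (\<lambda>i. n i mod p) {1..t} = restrict (\<lambda>i. n' i mod p) {1..t}"
          using eq by blast+
        from fun_cong[OF this(1), of i] fun_cong[OF this(2), of i] True
        have "n i div p = n' i div p" "n i mod p = n' i mod p" by simp_all
        thus ?thesis by (metis div_mult_mod_eq)
      next
        case False
        with nn show ?thesis by (simp add: V_set_def PiE_def extensional_def)
      qed
    qed
  qed
  have sub: "?h ` ?W \<subseteq> ?V \<times> ?B"
    using V_set_div[OF p, of _ t f b q] p0 by auto
  have finP: "finite (?V \<times> ?B)" using fin by (intro finite_cartesian_product finite_PiE) auto
  have "card ?W \<le> card (?V \<times> ?B)" by (rule card_inj_on_le[OF inj sub finP])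
  also have "\<dots> = p ^ t * card ?V" by (simp add: card_cartesian_product card_PiE)
  finally show ?thesis using finite_imageD[OF finite_subset[OF sub finP] inj] by simp
qed

text \<open>At level 1 every positive exponent puts the product into the ideal generated by \<open>b\<close>, so
  only the zero vector is left; the higher levels follow one at a time.\<close>

lemma finite_V_set:
  fixes f :: "nat \<Rightarrow> 'a::comm_ring_1"
  assumes p: "prime CHAR('a)" "p = CHAR('a)"
    and f: "\<And>i. i \<in> {1..t} \<Longrightarrow> f i \<in> b"
  shows "finite (V_set t (\<lambda>i. ideal_gen {f i}) b (p ^ e))"
proof (induction e)
  case 0
  have "V_set t (\<lambda>i. ideal_gen {f i}) b 1 \<subseteq> {\<lambda>i\<in>{1..t}. 0}"
  proof
    fix n assume n: "n \<in> V_set t (\<lambda>i. ideal_gen {f i}) b 1"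
    have "n i = 0" if i: "i \<in> {1..t}" for i
    proof (rule ccontr)
      assume "n i \<noteq> 0"
      hence "(\<Prod>j\<in>{1..t}. f j ^ n j) = (f i ^ (n i - 1) * (\<Prod>j\<in>{1..t}-{i}. f j ^ n j)) * f i"
        using i by (simp add: prod.remove[of _ i] power_eq_if mult_ac)
      moreover have "f i \<in> frobenius_power b 1"
        using f[OF i] by (auto simp: frobenius_power_def intro: ideal_gen_base)
      ultimately have "(\<Prod>j\<in>{1..t}. f j ^ n j) \<in> frobenius_power b 1"
        by (simp only: ideal_mult_left[OF is_ideal_frobenius_power])
      with n show False by (simp add: V_set_principal)
    qed
    thus "n \<in> {\<lambda>i\<in>{1..t}. 0}"
      using n by (auto simp: V_set_def PiE_def extensional_def fun_eq_iff)
  qed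
  thus ?case using finite_subset by fastforce
next
  case (Suc e)
  thus ?case using V_set_mult_CHAR[OF p Suc.IH] by (simp add: mult.commute)
qed

text \<open>By \<open>V_set_mult_CHAR\<close> the normalized cardinalities are decreasing in the level \<open>e\<close>. Hence
  they converge, and any lower bound on them at all levels passes to the limit.\<close>

lemma F_volume_principal_ge:
  fixes f :: "nat \<Rightarrow> 'a::comm_ring_1"
  assumes p: "prime CHAR('a)" "p = CHAR('a)"
    and f: "\<And>i. i \<in> {1..t} \<Longrightarrow> f i \<in> b"
    and lim: "x \<longlonglongrightarrow> L"
    and le: "\<And>e. x e \<le> real (card (V_set t (\<lambda>i. ideal_gen {f i}) b (p ^ e))) / real p ^ (e * t)"
  shows "L \<le> F_volume p t (\<lambda>i. ideal_gen {f i}) b"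
proof -
  define c where "c e = real (card (V_set t (\<lambda>i. ideal_gen {f i}) b (p ^ e))) / real p ^ (e * t)" for e
  have p0: "real p > 0" using p prime_gt_0_nat by auto
  have "decseq c"
  proof (rule decseq_SucI)
    fix e
    have "card (V_set t (\<lambda>i. ideal_gen {f i}) b (p ^ Suc e))
        \<le> p ^ t * card (V_set t (\<lambda>i. ideal_gen {f i}) b (p ^ e))"
      using V_set_mult_CHAR[OF p finite_V_set[where e = e, OF p f]] by (simp add: mult.commute)
    hence "real (card (V_set t (\<lambda>i. ideal_gen {f i}) b (p ^ Suc e)))
        \<le> real p ^ t * real (card (V_set t (\<lambda>i. ideal_gen {f i}) b (p ^ e)))"
      by (metis of_nat_le_iff of_nat_mult of_nat_power)
    thus "c (Suc e) \<le> c e"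
      using p0 by (simp add: c_def field_simps power_add)
  qed
  moreover have "Bseq c"
  proof (rule BseqI')
    show "norm (c e) \<le> c 0" for e
      using decseqD[OF \<open>decseq c\<close>, of 0 e] p0 by (simp add: c_def)
  qed
  ultimately have "convergent c" by (simp add: Bseq_monoseq_convergent decseq_imp_monoseq)
  hence "c \<longlonglongrightarrow> F_volume p t (\<lambda>i. ideal_gen {f i}) b"
    by (simp add: F_volume_def c_def[abs_def] convergent_LIMSEQ_iff)
  with lim show ?thesis by (rule LIMSEQ_le) (use le in \<open>auto simp: c_def\<close>)
qed

section \<open>Base p digits\<close>

text \<open>The integer with base \<open>p\<close> digits \<open>d 1, \<dots>, d e\<close>, most significant first: \<open>p ^ e\<close> times the
  truncation at \<open>e\<close> of the number with digit sequence \<open>d\<close>.\<close>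

primrec digits_value :: "nat \<Rightarrow> (nat \<Rightarrow> nat) \<Rightarrow> nat \<Rightarrow> nat" where
  "digits_value p d 0 = 0"
| "digits_value p d (Suc e) = p * digits_value p d e + d (Suc e)"

lemma digits_value_eq_sum:
  assumes "p > 0"
  shows "real (digits_value p d e) / real p ^ e = (\<Sum>k=1..e. real (d k) / real p ^ k)"
  using assms by (induction e) (simp_all add: field_simps)

lemma digits_value_cong: "(\<And>k. 1 \<le> k \<Longrightarrow> k \<le> e \<Longrightarrow> d k = d' k) \<Longrightarrow> digits_value p d e = digits_value p d' e"
  by (induction e) auto

lemma sums_iff_digits_value:
  assumes "p > 0"
  shows "(\<lambda>k. real (d (Suc k)) / real p ^ Suc k) sums x \<longleftrightarrow>
    (\<lambda>e. real (digits_value p d e) / real p ^ e) \<longlonglongrightarrow> x"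
  unfolding sums_def digits_value_eq_sum[OF assms]
  by (simp add: sum.atLeast1_atMost_eq)

text \<open>After normalization an error of one unit in the last place is \<open>1 / p ^ e\<close>.\<close>

lemma tendsto_if_digits_value_near:
  assumes p: "p \<ge> 2"
    and "\<And>e. real (digits_value p d e) \<le> x * real p ^ e"
    and "\<And>e. x * real p ^ e \<le> real (digits_value p d e) + 1"
  shows "(\<lambda>e. real (digits_value p d e) / real p ^ e) \<longlonglongrightarrow> x"
proof (rule tendsto_sandwich)
  have "(\<lambda>e. x - inverse (real p ^ e)) \<longlonglongrightarrow> x - 0"
    using p by (intro tendsto_intros LIMSEQ_inverse_realpow_zero) auto
  thus "(\<lambda>e. x - inverse (real p ^ e)) \<longlonglongrightarrow> x" by simp
  show "\<forall>\<^sub>F e in sequentially. x - inverse (real p ^ e) \<le> real (digits_value p d e) / real p ^ e"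
  proof (intro always_eventually allI)
    fix e
    have "x \<le> (real (digits_value p d e) + 1) / real p ^ e"
      using p assms(3)[of e] by (simp add: pos_le_divide_eq)
    thus "x - inverse (real p ^ e) \<le> real (digits_value p d e) / real p ^ e"
      by (simp add: add_divide_distrib inverse_eq_divide)
  qed
  show "\<forall>\<^sub>F e in sequentially. real (digits_value p d e) / real p ^ e \<le> x"
    using p assms(2) by (intro always_eventually) (simp add: field_simps)
qed simp

text \<open>The lower bound is strict because some later digit is positive. The upper bound holds
  because a prefix plus one unit in its last place never increases when it is prolonged.\<close>

lemma nonterminating_expansion_bounds:
  assumes p: "p \<ge> 2" and d: "nonterminating_expansion p x d"
  shows "real (digits_value p d e) < x * real p ^ e"
    and "x * real p ^ e \<le> real (digits_value p d e) + 1"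
proof -
  let ?v = "\<lambda>e. real (digits_value p d e) / real p ^ e"
  let ?g = "\<lambda>k. real (d (Suc k)) / real p ^ Suc k"
  have p0: "real p > 0" using p by simp
  have sums: "?g sums x" and dle: "\<And>k. k \<ge> 1 \<Longrightarrow> d k \<le> p - 1"
    using d by (auto simp: nonterminating_expansion_def)
  hence lim: "?v \<longlonglongrightarrow> x" using sums_iff_digits_value[of p d x] p by simp
  obtain k where k: "k \<ge> Suc e" "d k \<noteq> 0"
    using d unfolding nonterminating_expansion_def eventually_sequentially by blast
  then obtain k' where k': "k = Suc k'" "e \<le> k'" by (cases k) auto
  have "sum ?g {..<e} < suminf ?g"
    by (rule sum_less_suminf2[of _ e k']) (use sums k k' p0 in \<open>auto simp: sums_iff\<close>)
  hence "?v e < x"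
    using sums digits_value_eq_sum[of p d e] p by (simp add: sums_iff sum.atLeast1_atMost_eq)
  thus "real (digits_value p d e) < x * real p ^ e" using p0 by (simp add: field_simps)
  have "?v n \<le> (real (digits_value p d e) + 1) / real p ^ e" if "n \<ge> e" for n
  proof -
    have "(real (digits_value p d n) + 1) / real p ^ n \<le> (real (digits_value p d e) + 1) / real p ^ e"
      using that
    proof (induction n rule: dec_induct)
      case (step n)
      have "d (Suc n) + 1 \<le> p" using dle[of "Suc n"] p by simp
      hence "real (d (Suc n)) + 1 \<le> real p" by (metis of_nat_1 of_nat_add of_nat_le_iff)
      hence "(real (digits_value p d (Suc n)) + 1) / real p ^ Suc n
          \<le> (real p * real (digits_value p d n) + real p) / real p ^ Suc n"
        using p0 by (intro divide_right_mono) auto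
      also have "\<dots> = (real (digits_value p d n) + 1) / real p ^ n"
        using p0 by (simp add: field_simps)
      finally show ?case using step.IH by simp
    qed simp
    moreover have "?v n \<le> (real (digits_value p d n) + 1) / real p ^ n"
      using p0 by (simp add: divide_right_mono)
    ultimately show ?thesis by linarith
  qed
  hence "x \<le> (real (digits_value p d e) + 1) / real p ^ e"
    by (intro LIMSEQ_le_const2[OF lim]) auto
  thus "x * real p ^ e \<le> real (digits_value p d e) + 1" using p0 by (simp add: field_simps)
qed

text \<open>The bounds identify every prefix of an expansion as a ceiling, which gives both the
  uniqueness of the nonterminating expansion and a construction of it.\<close>

lemma ex1_nonterminating_expansion:
  assumes p: "p \<ge> 2" and x: "0 < x" "x \<le> 1"
  shows "\<exists>!d. nonterminating_expansion p x d"
proof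
  have p0: "real p > 0" using p by simp
  \<comment> \<open>The largest integer strictly below \<open>x * p ^ e\<close>; strictness excludes a tail of zeros.\<close>
  define N where "N e = nat (\<lceil>x * real p ^ e\<rceil> - 1)" for e
  have "1 \<le> \<lceil>x * real p ^ e\<rceil>" for e using x p0 by (simp add: le_ceiling_iff)
  hence N: "real (N e) = of_int \<lceil>x * real p ^ e\<rceil> - 1" for e
    by (simp add: N_def)
  have N1: "real (N e) < x * real p ^ e" for e
    unfolding N by linarith
  have N2: "x * real p ^ e \<le> real (N e) + 1" for e
    unfolding N by linarith
  define d where "d k = (if k = 0 then 0 else N k - p * N (k - 1))" for k
  have step: "p * N e \<le> N (Suc e)" "N (Suc e) \<le> p * N e + (p - 1)" for e
  proof -
    have "real p * real (N e) < real p * (x * real p ^ e)"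
      using N1[of e] p0 by (intro mult_strict_left_mono)
    also have "\<dots> \<le> real (N (Suc e)) + 1" using N2[of "Suc e"] by (simp add: mult_ac)
    finally have "real (p * N e) < real (N (Suc e) + 1)" by simp
    thus "p * N e \<le> N (Suc e)" unfolding of_nat_less_iff by simp
    have "real (N (Suc e)) < real p * (x * real p ^ e)" using N1[of "Suc e"] by (simp add: mult_ac)
    also have "\<dots> \<le> real p * (real (N e) + 1)" using N2[of e] p0 by (intro mult_left_mono) auto
    finally have "real (N (Suc e)) < real (p * N e + p)" by (simp add: algebra_simps)
    thus "N (Suc e) \<le> p * N e + (p - 1)" unfolding of_nat_less_iff using p by simp
  qed
  have val: "digits_value p d e = N e" for e
  proof (induction e)
    case 0
    have "real (N 0) < 1" using N1[of 0] x by simp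
    thus ?case by simp
  next
    case (Suc e)
    thus ?case using step(1)[of e] by (simp add: d_def)
  qed
  have lim: "(\<lambda>e. real (digits_value p d e) / real p ^ e) \<longlonglongrightarrow> x"
    using N1 N2 by (intro tendsto_if_digits_value_near[OF p]) (auto simp: val less_imp_le)
  have "\<not> (\<forall>\<^sub>F k in sequentially. d k = 0)"
  proof
    assume "\<forall>\<^sub>F k in sequentially. d k = 0"
    then obtain K where K: "\<And>k. k \<ge> K \<Longrightarrow> d k = 0" by (auto simp: eventually_sequentially)
    have "real (N n) / real p ^ n = real (N K) / real p ^ K" if "n \<ge> K" for n
      using that
    proof (induction n rule: dec_induct)
      case (step n)
      have "N (Suc n) = p * N n" using K[of "Suc n"] step.hyps val[of "Suc n"] val[of n] by simp
      thus ?case using step.IH p0 by simp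
    qed simp
    hence "(\<lambda>e. real (digits_value p d e) / real p ^ e) \<longlonglongrightarrow> real (N K) / real p ^ K"
      unfolding val by (intro tendsto_eventually eventually_sequentiallyI[of K])
    hence "x = real (N K) / real p ^ K" using lim LIMSEQ_unique by blast
    hence "x * real p ^ K = real (N K)" using p0 by simp
    thus False using N1[of K] by linarith
  qed
  moreover have "\<forall>k\<ge>1. d k \<le> p - 1"
  proof (intro allI impI)
    fix k :: nat assume "k \<ge> 1"
    thus "d k \<le> p - 1" using step[of "k - 1"] by (simp add: d_def)
  qed
  ultimately show "nonterminating_expansion p x d"
    using lim sums_iff_digits_value[of p d x] p
    unfolding nonterminating_expansion_def by (simp add: d_def[of 0])
  fix d' assume d': "nonterminating_expansion p x d'"
  have val': "digits_value p d' e = N e" for e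
  proof -
    have "real (digits_value p d' e) < real (N e + 1)" "real (N e) < real (digits_value p d' e + 1)"
      using nonterminating_expansion_bounds[OF p d', of e] N1[of e] N2[of e] by simp_all
    thus ?thesis unfolding of_nat_less_iff by simp
  qed
  show "d' = d"
  proof
    fix k show "d' k = d k"
    proof (cases k)
      case 0
      thus ?thesis using d' by (simp add: nonterminating_expansion_def d_def)
    next
      case (Suc e)
      thus ?thesis using val'[of e] val'[of "Suc e"] val[of e] val[of "Suc e"] by simp
    qed
  qed
qed

lemma nonterminating_expansion_digit:
  assumes "p \<ge> 2" "0 < x" "x \<le> 1"
  shows "nonterminating_expansion p x (digit p x)"
  using theI'[OF ex1_nonterminating_expansion[OF assms]] assms by (simp add: digit_def)

lemma digit_0 [simp]: "digit p 0 k = 0"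
  by (simp add: digit_def)

lemma digits_value_digit_less:
  "p \<ge> 2 \<Longrightarrow> 0 < x \<Longrightarrow> x \<le> 1 \<Longrightarrow> real (digits_value p (digit p x) e) < x * real p ^ e"
  by (rule nonterminating_expansion_bounds nonterminating_expansion_digit | assumption)+

lemma digits_value_eq_0: "(\<And>k. 1 \<le> k \<Longrightarrow> k \<le> e \<Longrightarrow> d k = 0) \<Longrightarrow> digits_value p d e = 0"
  by (induction e) auto

lemma digits_value_digit_tendsto:
  assumes "p \<ge> 2" "0 \<le> x" "x \<le> 1"
  shows "(\<lambda>e. real (digits_value p (digit p x) e) / real p ^ e) \<longlonglongrightarrow> x"
proof (cases "x = 0")
  case False
  thus ?thesis using assms sums_iff_digits_value[of p "digit p x" x]
      nonterminating_expansion_digit[of p x] by (simp add: nonterminating_expansion_def)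
qed (simp add: digits_value_eq_0)

lemma truncation_eq: "p > 0 \<Longrightarrow> truncation p e x = real (digits_value p (digit p x) e) / real p ^ e"
  by (simp add: truncation_def digits_value_eq_sum)

section \<open>Carry-free approximation of a block from below\<close>

lemma ex_le_with_sum:
  fixes g :: "'a \<Rightarrow> nat"
  assumes "finite K" "n \<le> sum g K"
  shows "\<exists>h. (\<forall>a\<in>K. h a \<le> g a) \<and> sum h K = n"
  using assms
proof (induction K arbitrary: n rule: finite_induct)
  case (insert b K)
  have "n - min n (g b) \<le> sum g K" using insert.prems insert.hyps by auto
  then obtain h where h: "\<forall>a\<in>K. h a \<le> g a" "sum h K = n - min n (g b)"
    using insert.IH by blast
  have "sum (h(b := min n (g b))) K = sum h K"
    using insert.hyps by (intro sum.cong) auto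
  hence "sum (h(b := min n (g b))) (insert b K) = n" using insert.hyps h(2) by simp
  moreover have "\<forall>a\<in>insert b K. (h(b := min n (g b))) a \<le> g a" using h(1) by auto
  ultimately show ?case by blast
qed auto

text \<open>The entries of \<open>\<delta>\<close> are digit sequences of lower approximations to the entries of \<open>x\<close> that
  can be added without carries. Strictness at the positive entries is what later makes
  exponents smaller than \<open>q\<close>, rather than at most \<open>q\<close>.\<close>

definition carry_free_below :: "nat \<Rightarrow> 'a set \<Rightarrow> ('a \<Rightarrow> real) \<Rightarrow> ('a \<Rightarrow> nat \<Rightarrow> nat) \<Rightarrow> bool" where
  "carry_free_below p K x \<delta> \<longleftrightarrow>
     (\<forall>k. (\<Sum>a\<in>K. \<delta> a k) \<le> p - 1) \<and>
     (\<forall>a\<in>K. \<forall>e. if x a = 0 then digits_value p (\<delta> a) e = 0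
                  else real (digits_value p (\<delta> a) e) < x a * real p ^ e)"

lemma carry_free_below_digit:
  assumes p: "p \<ge> 2" and K: "finite K" and x: "\<And>a. a \<in> K \<Longrightarrow> 0 \<le> x a \<and> x a \<le> 1"
    and nc: "\<And>k. (\<Sum>a\<in>K. digit p (x a) k) \<le> p - 1"
  shows "carry_free_below p K x (\<lambda>a. digit p (x a))"
    and "(\<lambda>e. real ((\<Sum>a\<in>K. digits_value p (digit p (x a)) e) + 1) / real p ^ e) \<longlonglongrightarrow> (\<Sum>a\<in>K. x a)"
proof -
  show "carry_free_below p K x (\<lambda>a. digit p (x a))"
    using x nc digits_value_digit_less[OF p]
    by (auto simp: carry_free_below_def digits_value_eq_0 le_less)
  have "(\<lambda>e. (\<Sum>a\<in>K. real (digits_value p (digit p (x a)) e) / real p ^ e) + inverse (real p ^ e))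
      \<longlonglongrightarrow> (\<Sum>a\<in>K. x a) + 0"
    using p x by (intro tendsto_intros LIMSEQ_inverse_realpow_zero digits_value_digit_tendsto) auto
  thus "(\<lambda>e. real ((\<Sum>a\<in>K. digits_value p (digit p (x a)) e) + 1) / real p ^ e) \<longlonglongrightarrow> (\<Sum>a\<in>K. x a)"
    by (simp add: add_divide_distrib sum_divide_distrib inverse_eq_divide add.commute)
qed

text \<open>When the digits in position \<open>s + 1\<close> produce a carry, lower them until their sum is
  \<open>p - 1\<close>. Some entry \<open>b\<close> becomes strictly smaller, and this leaves room to give it the digit
  \<open>p - 1\<close> in all later positions while it stays below \<open>x b\<close>. The column sums are then \<open>p - 1\<close>
  in every position after \<open>s\<close>, so the total reaches \<open>1 / p ^ s\<close> above the truncation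
  at \<open>s\<close>, short of one unit in the last place.\<close>

lemma carry_free_below_at_carry:
  assumes p: "p \<ge> 2" and K: "finite K" and x: "\<And>a. a \<in> K \<Longrightarrow> 0 \<le> x a \<and> x a \<le> 1"
    and nc: "\<And>k. k \<le> s \<Longrightarrow> (\<Sum>a\<in>K. digit p (x a) k) \<le> p - 1"
    and carry: "(\<Sum>a\<in>K. digit p (x a) (Suc s)) > p - 1"
  obtains \<delta> where "carry_free_below p K x \<delta>"
    and "(\<lambda>e. real ((\<Sum>a\<in>K. digits_value p (\<delta> a) e) + 1) / real p ^ e)
           \<longlonglongrightarrow> (\<Sum>a\<in>K. truncation p s (x a)) + 1 / real p ^ s"
proof -
  have p0: "real p > 0" using p by simp
  obtain h where h: "\<And>a. a \<in> K \<Longrightarrow> h a \<le> digit p (x a) (Suc s)" "sum h K = p - 1"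
    using ex_le_with_sum[OF K, of "p - 1" "\<lambda>a. digit p (x a) (Suc s)"] carry by auto
  obtain b where b: "b \<in> K" "h b < digit p (x b) (Suc s)"
  proof (rule ccontr)
    assume "\<not> thesis"
    hence "(\<Sum>a\<in>K. digit p (x a) (Suc s)) \<le> sum h K" by (intro sum_mono) (use that in force)
    with h(2) carry show False by simp
  qed
  define \<delta> where "\<delta> a k = (if k \<le> s then digit p (x a) k else if k = Suc s then h a
      else if a = b then p - 1 else 0)" for a k
  have trunc: "digits_value p (\<delta> a) e = digits_value p (digit p (x a)) e" if "e \<le> s" for a e
    using that by (intro digits_value_cong) (auto simp: \<delta>_def)
  have at: "digits_value p (\<delta> a) (Suc s) = p * digits_value p (digit p (x a)) s + h a" for a
    using trunc[of s a] by (simp add: \<delta>_def)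
  have colsum: "(\<Sum>a\<in>K. \<delta> a k) = p - 1" if "k > s" for k
    using that K b(1) h(2) by (cases "k = Suc s") (simp_all add: \<delta>_def)
  have other: "digits_value p (\<delta> a) e \<le> digits_value p (digit p (x a)) e" if "a \<in> K" "a \<noteq> b" for a e
  proof (induction e)
    case (Suc e)
    have "\<delta> a (Suc e) \<le> digit p (x a) (Suc e)" using that h(1)[of a] by (simp add: \<delta>_def)
    thus ?case using Suc.IH by (simp add: add_mono)
  qed simp
  \<comment> \<open>The strict decrease at \<open>b\<close> absorbs the tail of digits \<open>p - 1\<close>.\<close>
  have at_b: "digits_value p (\<delta> b) e + 1 \<le> p ^ (e - Suc s) * digits_value p (digit p (x b)) (Suc s)"
    if "e \<ge> Suc s" for e
    using that
  proof (induction e rule: dec_induct)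
    case base
    thus ?case using b(2) at[of b] by simp
  next
    case (step e)
    have "digits_value p (\<delta> b) (Suc e) + 1 = p * (digits_value p (\<delta> b) e + 1)"
      using step.hyps p by (simp add: \<delta>_def)
    also have "\<dots> \<le> p * (p ^ (e - Suc s) * digits_value p (digit p (x b)) (Suc s))"
      using step.IH by (rule mult_le_mono2)
    also have "\<dots> = p ^ (Suc e - Suc s) * digits_value p (digit p (x b)) (Suc s)"
      using step.hyps by (simp only: Suc_diff_le power_Suc mult.assoc)
    finally show ?case .
  qed
  have "x b \<noteq> 0" using b(2) by auto
  hence xb: "0 < x b" "x b \<le> 1" using x[OF b(1)] by auto
  have below_b: "real (digits_value p (\<delta> b) e) < x b * real p ^ e" for e
  proof (cases "e \<le> s")
    case True
    thus ?thesis using trunc digits_value_digit_less[OF p xb] by simp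
  next
    case False
    hence "real (digits_value p (\<delta> b) e + 1)
        \<le> real (p ^ (e - Suc s) * digits_value p (digit p (x b)) (Suc s))"
      using at_b[of e] by (simp only: of_nat_le_iff)
    also have "\<dots> \<le> real p ^ (e - Suc s) * (x b * real p ^ Suc s)"
      using digits_value_digit_less[OF p xb, of "Suc s"]
      by (simp only: of_nat_mult of_nat_power) (intro mult_left_mono, auto)
    also have "\<dots> = x b * real p ^ e" using False by (simp flip: power_add power_Suc)
    finally show ?thesis by simp
  qed
  have "carry_free_below p K x \<delta>"
    unfolding carry_free_below_def
  proof (intro conjI allI ballI)
    fix k show "(\<Sum>a\<in>K. \<delta> a k) \<le> p - 1"
      using nc[of k] colsum[of k] by (cases "k \<le> s") (simp_all add: \<delta>_def)
  next
    fix a e assume a: "a \<in> K"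
    show "if x a = 0 then digits_value p (\<delta> a) e = 0
          else real (digits_value p (\<delta> a) e) < x a * real p ^ e"
    proof (cases "a = b")
      case True
      thus ?thesis using \<open>x b \<noteq> 0\<close> below_b by simp
    next
      case False
      show ?thesis
        using other[OF a False, of e] x[OF a] digits_value_digit_less[OF p, of "x a" e]
        by (auto simp: digits_value_eq_0)
    qed
  qed
  moreover
  have const: "real ((\<Sum>a\<in>K. digits_value p (\<delta> a) e) + 1) / real p ^ e
      = (\<Sum>a\<in>K. truncation p s (x a)) + 1 / real p ^ s" if "e \<ge> s" for e
    using that
  proof (induction e rule: dec_induct)
    case base
    thus ?case using p by (simp add: trunc truncation_eq add_divide_distrib sum_divide_distrib)
  next
    case (step e)
    have "(\<Sum>a\<in>K. digits_value p (\<delta> a) (Suc e)) + 1 = p * ((\<Sum>a\<in>K. digits_value p (\<delta> a) e) + 1)"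
      using colsum[of "Suc e"] step.hyps p by (simp add: sum.distrib sum_distrib_left)
    hence "real ((\<Sum>a\<in>K. digits_value p (\<delta> a) (Suc e)) + 1) / real p ^ Suc e
        = real ((\<Sum>a\<in>K. digits_value p (\<delta> a) e) + 1) / real p ^ e"
      using p0 by (simp only: of_nat_mult power_Suc) simp
    with step.IH show ?case by simp
  qed
  have "(\<lambda>e. real ((\<Sum>a\<in>K. digits_value p (\<delta> a) e) + 1) / real p ^ e)
           \<longlonglongrightarrow> (\<Sum>a\<in>K. truncation p s (x a)) + 1 / real p ^ s"
    by (intro tendsto_eventually eventually_sequentiallyI[of s] const)
  ultimately show thesis using that by blast
qed

section \<open>Multinomial coefficients without carries\<close>

text \<open>One step of Legendre's formula: exactly the factors \<open>p, 2 * p, \<dots>\<close> of the factorial are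
  divisible by \<open>p\<close>, and dividing each of them by \<open>p\<close> leaves the factorial of \<open>m div p\<close>.\<close>

lemma multiplicity_fact:
  fixes p m :: nat
  assumes p: "prime p"
  shows "multiplicity p (fact m :: nat) = m div p + multiplicity p (fact (m div p) :: nat)"
proof (induction m)
  case 0
  show ?case by simp
next
  case (Suc m)
  have p1: "\<not> is_unit p" "prime_elem p" "p > 0" using p prime_gt_0_nat by auto
  have expand: "multiplicity p (fact (Suc n) :: nat) = multiplicity p (Suc n) + multiplicity p (fact n :: nat)" for n
    by (subst prime_elem_multiplicity_mult_distrib[OF p1(2), symmetric]) simp_all
  show ?case
  proof (cases "p dvd Suc m")
    case True
    hence q: "Suc m div p = Suc (m div p)" by (simp add: div_Suc dvd_eq_mod_eq_0)
    have "Suc m = p * Suc (m div p)" using True q by (metis dvd_mult_div_cancel)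
    hence "multiplicity p (Suc m) = Suc (multiplicity p (Suc (m div p)))"
      using p1 by (simp only: multiplicity_times_same[OF nat.distinct(2) p1(1)])
    thus ?thesis using Suc.IH expand[of m] expand[of "m div p"] q by simp
  next
    case False
    hence "Suc m div p = m div p" by (simp add: div_Suc dvd_eq_mod_eq_0)
    thus ?thesis using Suc.IH expand[of m] False by (simp add: not_dvd_imp_multiplicity_0)
  qed
qed

text \<open>Without carries, dividing by \<open>p\<close> with remainder commutes with the sum over \<open>K\<close>, so both
  sides lose the same amount in every step of Legendre's formula.\<close>

lemma multiplicity_fact_carry_free:
  fixes p :: nat
  assumes p: "prime p" and K: "finite K" and nc: "\<And>k. (\<Sum>a\<in>K. \<delta> a k) \<le> p - 1"
  shows "multiplicity p (fact (\<Sum>a\<in>K. digits_value p (\<delta> a) e) :: nat)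
    = (\<Sum>a\<in>K. multiplicity p (fact (digits_value p (\<delta> a) e) :: nat))"
proof (induction e)
  case (Suc e)
  have p0: "p > 0" using p prime_gt_0_nat by blast
  have lt: "(\<Sum>a\<in>K. \<delta> a (Suc e)) < p" using nc[of "Suc e"] p0 by linarith
  have "\<delta> a (Suc e) < p" if "a \<in> K" for a
    using member_le_sum[OF that, of "\<lambda>a. \<delta> a (Suc e)"] K lt by simp
  hence each: "digits_value p (\<delta> a) (Suc e) div p = digits_value p (\<delta> a) e" if "a \<in> K" for a
    using that p0 by simp
  have "(\<Sum>a\<in>K. digits_value p (\<delta> a) (Suc e))
      = p * (\<Sum>a\<in>K. digits_value p (\<delta> a) e) + (\<Sum>a\<in>K. \<delta> a (Suc e))"
    by (simp add: sum.distrib sum_distrib_left)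
  hence total: "(\<Sum>a\<in>K. digits_value p (\<delta> a) (Suc e)) div p = (\<Sum>a\<in>K. digits_value p (\<delta> a) e)"
    using lt p0 by simp
  have "multiplicity p (fact (\<Sum>a\<in>K. digits_value p (\<delta> a) (Suc e)) :: nat)
      = (\<Sum>a\<in>K. digits_value p (\<delta> a) e + multiplicity p (fact (digits_value p (\<delta> a) e) :: nat))"
    by (subst multiplicity_fact[OF p]) (simp only: total Suc.IH sum.distrib)
  also have "\<dots> = (\<Sum>a\<in>K. multiplicity p (fact (digits_value p (\<delta> a) (Suc e)) :: nat))"
    by (intro sum.cong refl) (subst multiplicity_fact[OF p, of "digits_value _ _ (Suc e)"], simp only: each)
  finally show ?case .
qed simp

definition multinomial :: "'a set \<Rightarrow> ('a \<Rightarrow> nat) \<Rightarrow> nat" where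
  "multinomial K \<gamma> = fact (sum \<gamma> K) div (\<Prod>a\<in>K. fact (\<gamma> a))"

lemma multinomial_fact:
  assumes "finite K"
  shows "multinomial K \<gamma> * (\<Prod>a\<in>K. fact (\<gamma> a)) = fact (sum \<gamma> K)"
proof -
  have "(\<Prod>a\<in>K. fact (\<gamma> a)) dvd (fact (sum \<gamma> K) :: nat)"
    using assms
  proof (induction K rule: finite_induct)
    case (insert b K)
    have "fact (\<gamma> b) * (\<Prod>a\<in>K. fact (\<gamma> a)) dvd fact (\<gamma> b) * (fact (sum \<gamma> K) :: nat)"
      using insert.IH by (rule mult_dvd_mono[OF dvd_refl])
    also have "\<dots> dvd fact (\<gamma> b + sum \<gamma> K)" by (rule fact_fact_dvd_fact)
    finally show ?case using insert.hyps by simp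
  qed simp
  thus ?thesis by (simp add: multinomial_def)
qed

text \<open>This recursion reduces the multinomial theorem to the binomial theorem.\<close>

lemma multinomial_insert:
  assumes "finite K" "b \<notin> K"
  shows "multinomial (insert b K) \<gamma> = (sum \<gamma> (insert b K) choose \<gamma> b) * multinomial K \<gamma>"
proof -
  let ?P = "fact (\<gamma> b) * (\<Prod>a\<in>K. fact (\<gamma> a)) :: nat"
  have "multinomial (insert b K) \<gamma> * ?P = fact (\<gamma> b + sum \<gamma> K)"
    using multinomial_fact[of "insert b K" \<gamma>] assms by simp
  also have "\<dots> = fact (\<gamma> b) * fact (sum \<gamma> K) * (\<gamma> b + sum \<gamma> K choose \<gamma> b)"
    using binomial_fact_lemma[of "\<gamma> b" "\<gamma> b + sum \<gamma> K"] by simp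
  also have "\<dots> = (sum \<gamma> (insert b K) choose \<gamma> b) * multinomial K \<gamma> * ?P"
    using multinomial_fact[OF assms(1), of \<gamma>, symmetric] assms by (simp add: mult_ac)
  finally show ?thesis using assms(1) by (simp only: mult_cancel2) (auto simp: prod_zero_iff)
qed

lemma multinomial_cong: "(\<And>a. a \<in> K \<Longrightarrow> \<gamma> a = \<gamma>' a) \<Longrightarrow> multinomial K \<gamma> = multinomial K \<gamma>'"
  unfolding multinomial_def by (simp cong: sum.cong prod.cong)

text \<open>The direction of Kummer's theorem in which the absence of carries makes the
  coefficient a unit modulo \<open>p\<close>.\<close>

lemma not_dvd_multinomial_carry_free:
  fixes p :: nat
  assumes p: "prime p" and K: "finite K" and nc: "\<And>k. (\<Sum>a\<in>K. \<delta> a k) \<le> p - 1"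
  shows "\<not> p dvd multinomial K (\<lambda>a. digits_value p (\<delta> a) e)"
proof -
  let ?\<gamma> = "\<lambda>a. digits_value p (\<delta> a) e"
  have pe: "prime_elem p" using p by auto
  have nz: "multinomial K ?\<gamma> \<noteq> 0"
    using multinomial_fact[OF K, of ?\<gamma>] by (metis fact_nonzero mult_eq_0_iff)
  have "multiplicity p (fact (sum ?\<gamma> K) :: nat)
      = multiplicity p (multinomial K ?\<gamma>) + multiplicity p (\<Prod>a\<in>K. fact (?\<gamma> a) :: nat)"
    unfolding multinomial_fact[OF K, of ?\<gamma>, symmetric]
    using nz K by (intro prime_elem_multiplicity_mult_distrib[OF pe]) auto
  also have "multiplicity p (\<Prod>a\<in>K. fact (?\<gamma> a) :: nat) = (\<Sum>a\<in>K. multiplicity p (fact (?\<gamma> a) :: nat))"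
    using K by (intro prime_elem_multiplicity_prod_distrib[OF pe]) auto
  finally have "multiplicity p (multinomial K ?\<gamma>) = 0"
    using multiplicity_fact_carry_free[where e = e, OF p K nc] by simp
  thus ?thesis using nz p multiplicity_eq_zero_iff[of "multinomial K ?\<gamma>" p] not_prime_unit by blast
qed

text \<open>Prescribing the value 0 outside \<open>K\<close> makes such a function determined by its values on
  \<open>K\<close>, and makes it usable as an exponent vector on any larger index set.\<close>

definition compositions :: "'a set \<Rightarrow> nat \<Rightarrow> ('a \<Rightarrow> nat) set" where
  "compositions K n = {\<gamma>. (\<forall>a. a \<notin> K \<longrightarrow> \<gamma> a = 0) \<and> sum \<gamma> K = n}"

lemma finite_compositions:
  assumes "finite K"
  shows "finite (compositions K n)"
proof (rule finite_subset)
  show "compositions K n \<subseteq> {\<gamma>. \<forall>a. (a \<in> K \<longrightarrow> \<gamma> a \<in> {..n}) \<and> (a \<notin> K \<longrightarrow> \<gamma> a = 0)}"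
    using assms by (auto simp: compositions_def intro: member_le_sum)
  show "finite {\<gamma>. \<forall>a. (a \<in> K \<longrightarrow> \<gamma> a \<in> {..n}) \<and> (a \<notin> K \<longrightarrow> \<gamma> a = (0 :: nat))}"
    using assms by (intro finite_set_of_finite_funs) auto
qed

lemma multinomial_theorem:
  fixes u :: "'a \<Rightarrow> 'b::comm_semiring_1"
  assumes "finite K"
  shows "(\<Sum>a\<in>K. u a) ^ n = (\<Sum>\<gamma>\<in>compositions K n. of_nat (multinomial K \<gamma>) * (\<Prod>a\<in>K. u a ^ \<gamma> a))"
  using assms
proof (induction K arbitrary: n rule: finite_induct)
  case empty
  have "compositions ({} :: 'a set) n = (if n = 0 then {\<lambda>_. 0} else {})"
    by (auto simp: compositions_def)
  thus ?case by (simp add: multinomial_def power_0_left)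
next
  case (insert b K)
  let ?T = "\<lambda>\<gamma>. of_nat (multinomial (insert b K) \<gamma>) * (\<Prod>a\<in>insert b K. u a ^ \<gamma> a)"
  let ?D = "SIGMA k:{..n}. compositions K (n - k)"
  have sum_upd: "sum (\<gamma>(b := k)) K = sum \<gamma> K" for \<gamma> :: "'a \<Rightarrow> nat" and k
    using insert.hyps by (intro sum.cong) auto
  have prod_upd: "(\<Prod>a\<in>K. u a ^ (\<gamma>(b := k)) a) = (\<Prod>a\<in>K. u a ^ \<gamma> a)" for \<gamma> k
    using insert.hyps by (intro prod.cong) auto
  have multi_upd: "multinomial K (\<gamma>(b := k)) = multinomial K \<gamma>" for \<gamma> k
    using insert.hyps by (intro multinomial_cong) auto
  have "(\<Sum>a\<in>insert b K. u a) ^ n = (\<Sum>k\<le>n. of_nat (n choose k) * u b ^ k * (\<Sum>a\<in>K. u a) ^ (n - k))"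
    using insert.hyps by (simp add: binomial_ring)
  also have "\<dots> = (\<Sum>k\<le>n. \<Sum>\<gamma>\<in>compositions K (n - k).
      of_nat (n choose k) * u b ^ k * (of_nat (multinomial K \<gamma>) * (\<Prod>a\<in>K. u a ^ \<gamma> a)))"
    by (simp only: insert.IH sum_distrib_left)
  also have "\<dots> = (\<Sum>(k, \<gamma>)\<in>?D.
      of_nat (n choose k) * u b ^ k * (of_nat (multinomial K \<gamma>) * (\<Prod>a\<in>K. u a ^ \<gamma> a)))"
    using insert.hyps by (subst sum.Sigma) (auto simp: finite_compositions)
  also have "\<dots> = (\<Sum>\<gamma>\<in>compositions (insert b K) n. ?T \<gamma>)"
  proof (rule sum.reindex_bij_witness[where j = "\<lambda>(k, \<gamma>). \<gamma>(b := k)" and i = "\<lambda>\<gamma>. (\<gamma> b, \<gamma>(b := 0))"])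
    fix x assume x: "x \<in> ?D"
    then obtain k \<gamma> where [simp]: "x = (k, \<gamma>)" and k: "k \<le> n" and \<gamma>: "\<gamma> \<in> compositions K (n - k)"
      by auto
    have "\<gamma> b = 0" using \<gamma> insert.hyps by (simp add: compositions_def)
    thus "((case x of (k, \<gamma>) \<Rightarrow> \<gamma>(b := k)) b, (case x of (k, \<gamma>) \<Rightarrow> \<gamma>(b := k))(b := 0)) = x"
      by (auto simp: fun_eq_iff)
    have total: "sum (\<gamma>(b := k)) (insert b K) = n"
      using \<gamma> k insert.hyps sum_upd[of \<gamma> k] by (simp add: compositions_def)
    moreover have "\<forall>a. a \<notin> insert b K \<longrightarrow> (\<gamma>(b := k)) a = 0"
      using \<gamma> by (simp add: compositions_def)
    ultimately show "(case x of (k, \<gamma>) \<Rightarrow> \<gamma>(b := k)) \<in> compositions (insert b K) n"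
      by (simp only: compositions_def mem_Collect_eq \<open>x = (k, \<gamma>)\<close> prod.case simp_thms)
    from total show "?T (case x of (k, \<gamma>) \<Rightarrow> \<gamma>(b := k)) = (case x of (k, \<gamma>) \<Rightarrow>
        of_nat (n choose k) * u b ^ k * (of_nat (multinomial K \<gamma>) * (\<Prod>a\<in>K. u a ^ \<gamma> a)))"
      using insert.hyps prod_upd[of \<gamma> k] by (simp add: multinomial_insert multi_upd mult_ac)
  next
    fix \<gamma> assume \<gamma>: "\<gamma> \<in> compositions (insert b K) n"
    show "(case (\<gamma> b, \<gamma>(b := 0)) of (k, \<gamma>) \<Rightarrow> \<gamma>(b := k)) = \<gamma>" by (simp add: fun_eq_iff)
    have "\<gamma> b + sum \<gamma> K = n" "\<forall>a. a \<notin> insert b K \<longrightarrow> \<gamma> a = 0"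
      using \<gamma> insert.hyps by (auto simp: compositions_def)
    thus "(\<gamma> b, \<gamma>(b := 0)) \<in> ?D" using sum_upd[of \<gamma> 0] by (auto simp: compositions_def)
  qed
  finally show ?case .
qed

section \<open>Monomials and coefficients\<close>

lemma CHAR_poly_mapping: "CHAR('a::comm_monoid_add \<Rightarrow>\<^sub>0 'b::comm_ring_1) = CHAR('b)"
proof (rule CHAR_eqI)
  have of_nat: "(of_nat n :: 'a \<Rightarrow>\<^sub>0 'b) = 0 \<longleftrightarrow> of_nat n = (0 :: 'b)" for n
  proof
    assume "(of_nat n :: 'a \<Rightarrow>\<^sub>0 'b) = 0"
    hence "Poly_Mapping.lookup (of_nat n :: 'a \<Rightarrow>\<^sub>0 'b) 0 = 0" by simp
    thus "of_nat n = (0 :: 'b)" by (simp only: lookup_of_nat) simp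
  next
    assume "of_nat n = (0 :: 'b)"
    hence "Poly_Mapping.single (0 :: 'a) (of_nat n :: 'b) = 0" by (simp only: single_zero)
    thus "(of_nat n :: 'a \<Rightarrow>\<^sub>0 'b) = 0" by (simp only: single_of_nat)
  qed
  show "of_nat CHAR('b) = (0 :: 'a \<Rightarrow>\<^sub>0 'b)" by (simp only: of_nat of_nat_CHAR)
  show "CHAR('b) dvd n" if "of_nat n = (0 :: 'a \<Rightarrow>\<^sub>0 'b)" for n
    using that by (simp only: of_nat of_nat_eq_0_iff_char_dvd)
qed

lemma poly_mapping_sum_single:
  "u = (\<Sum>a\<in>Poly_Mapping.keys u. Poly_Mapping.single a (Poly_Mapping.lookup u a))"
proof (rule poly_mapping_eqI)
  fix b
  have "(\<Sum>a\<in>Poly_Mapping.keys u. Poly_Mapping.lookup (Poly_Mapping.single a (Poly_Mapping.lookup u a)) b)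
      = (\<Sum>a\<in>Poly_Mapping.keys u. if a = b then Poly_Mapping.lookup u a else 0)"
    by (intro sum.cong) (auto simp: lookup_single when_def)
  thus "Poly_Mapping.lookup u b = Poly_Mapping.lookup (\<Sum>a\<in>Poly_Mapping.keys u.
      Poly_Mapping.single a (Poly_Mapping.lookup u a)) b"
    by (simp add: lookup_sum in_keys_iff)
qed

text \<open>The exponent \<open>n \<cdot> a\<close> of the \<open>n\<close>-th power of the monomial with exponent \<open>a\<close>.\<close>

definition exponent_multiple :: "nat \<Rightarrow> ('m \<Rightarrow>\<^sub>0 nat) \<Rightarrow> ('m \<Rightarrow>\<^sub>0 nat)" where
  "exponent_multiple n a = (\<Sum>j<n. a)"

lemma lookup_exponent_multiple [simp]:
  "Poly_Mapping.lookup (exponent_multiple n a) r = n * Poly_Mapping.lookup a r"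
  by (simp add: exponent_multiple_def lookup_sum)

lemma single_power:
  "Poly_Mapping.single a (c :: 'k::comm_ring_1) ^ n = Poly_Mapping.single (exponent_multiple n a) (c ^ n)"
  by (induction n) (simp_all add: exponent_multiple_def mult_single add.commute mult.commute)

lemma prod_single:
  "(\<Prod>i\<in>A. Poly_Mapping.single (a i :: 'b::comm_monoid_add) (c i :: 'k::comm_ring_1))
    = Poly_Mapping.single (\<Sum>i\<in>A. a i) (\<Prod>i\<in>A. c i)"
  by (induction A rule: infinite_finite_induct) (simp_all add: mult_single)

text \<open>The monomial ideal generated by the \<open>q\<close>-th powers of the variables: membership can be read
  off from the support.\<close>

definition high_degree :: "nat \<Rightarrow> ('m, 'k::comm_ring_1) mpoly set" where
  "high_degree q = {u. \<forall>a\<in>Poly_Mapping.keys u. \<exists>r. q \<le> Poly_Mapping.lookup a r}"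

lemma is_ideal_high_degree: "is_ideal (high_degree q :: ('m, 'k::comm_ring_1) mpoly set)"
  unfolding is_ideal_def
proof (intro conjI ballI allI)
  show "(0 :: ('m, 'k) mpoly) \<in> high_degree q" by (simp add: high_degree_def)
  fix u v :: "('m, 'k) mpoly" assume u: "u \<in> high_degree q"
  show "u + v \<in> high_degree q" if "v \<in> high_degree q"
    using u that keys_add[of u v] by (auto simp: high_degree_def)
  show "v * u \<in> high_degree q"
    unfolding high_degree_def
  proof (intro CollectI ballI)
    fix c assume "c \<in> Poly_Mapping.keys (v * u)"
    then obtain a b where "c = a + b" "b \<in> Poly_Mapping.keys u"
      using keys_mult[of v u] by auto
    moreover then obtain r where "q \<le> Poly_Mapping.lookup b r"
      using u by (auto simp: high_degree_def)
    ultimately show "\<exists>r. q \<le> Poly_Mapping.lookup c r"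
      by (intro exI[of _ r]) (simp add: lookup_add)
  qed
qed

text \<open>For a power \<open>q\<close> of the characteristic, the polynomials \<open>u\<close> with \<open>u ^ q\<close> in this monomial
  ideal form an ideal themselves, so it is enough to look at the variables.\<close>

lemma frobenius_power_irrelevant_subset:
  assumes p: "prime CHAR('k::comm_ring_1)" and q: "q = CHAR('k) ^ e"
  shows "frobenius_power (irrelevant_ideal :: ('m, 'k) mpoly set) q \<subseteq> high_degree q"
  unfolding frobenius_power_def
proof (rule ideal_gen_least)
  have p': "prime CHAR(('m, 'k) mpoly)" and q': "q = CHAR(('m, 'k) mpoly) ^ e"
    using p q by (simp_all add: CHAR_poly_mapping)
  have q0: "q > 0" using p q by (simp add: prime_gt_0_nat)
  have "irrelevant_ideal \<subseteq> {u :: ('m, 'k) mpoly. u ^ q \<in> high_degree q}"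
    unfolding irrelevant_ideal_def
  proof (rule ideal_gen_least)
    show "range variable \<subseteq> {u :: ('m, 'k) mpoly. u ^ q \<in> high_degree q}"
    proof
      fix u :: "('m, 'k) mpoly" assume "u \<in> range variable"
      then obtain r where u: "u = variable r" by blast
      have "\<exists>r'. q \<le> Poly_Mapping.lookup (exponent_multiple q (Poly_Mapping.single r 1)) r'"
        by (rule exI[of _ r]) simp
      thus "u \<in> {u. u ^ q \<in> high_degree q}"
        by (simp add: u variable_def single_power high_degree_def)
    qed
    show "is_ideal {u :: ('m, 'k) mpoly. u ^ q \<in> high_degree q}"
      using is_ideal_high_degree[of q] q0
      by (auto simp: is_ideal_def freshmans_dream'[OF p' q'] power_mult_distrib power_0_left)
  qed
  thus "(\<lambda>u. u ^ q) ` irrelevant_ideal \<subseteq> (high_degree q :: ('m, 'k) mpoly set)" by blast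
qed (rule is_ideal_high_degree)

lemma irrelevant_ideal_no_constant:
  fixes u :: "('m, 'k::comm_ring_1) mpoly"
  assumes "u \<in> irrelevant_ideal"
  shows "0 \<notin> Poly_Mapping.keys u"
proof -
  have "irrelevant_ideal \<subseteq> (high_degree 1 :: ('m, 'k) mpoly set)"
    unfolding irrelevant_ideal_def
    by (rule ideal_gen_least[OF _ is_ideal_high_degree])
      (auto simp: variable_def high_degree_def lookup_single when_def)
  with assms have "u \<in> high_degree 1" by blast
  thus ?thesis by (fastforce simp: high_degree_def)
qed

text \<open>The exponent of the monomial obtained by choosing \<open>\<gamma> i a\<close> times the monomial \<open>a\<close> from the
  \<open>i\<close>-th factor.\<close>

definition total_exponent ::
  "nat set \<Rightarrow> (nat \<Rightarrow> ('m \<Rightarrow>\<^sub>0 nat) set) \<Rightarrow> (nat \<Rightarrow> ('m \<Rightarrow>\<^sub>0 nat) \<Rightarrow> nat) \<Rightarrow> ('m \<Rightarrow>\<^sub>0 nat)" where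
  "total_exponent J K \<gamma> = (\<Sum>i\<in>J. \<Sum>a\<in>K i. exponent_multiple (\<gamma> i a) a)"

lemma lookup_total_exponent:
  "Poly_Mapping.lookup (total_exponent J K \<gamma>) r = (\<Sum>i\<in>J. \<Sum>a\<in>K i. \<gamma> i a * Poly_Mapping.lookup a r)"
  by (simp add: total_exponent_def lookup_sum)

lemma lookup_prod_power:
  fixes f :: "nat \<Rightarrow> ('m, 'k::comm_ring_1) mpoly"
  assumes "finite J"
  shows "Poly_Mapping.lookup (\<Prod>i\<in>J. f i ^ n i) E =
    (\<Sum>\<gamma>\<in>{\<gamma>\<in>Pi\<^sub>E J (\<lambda>i. compositions (Poly_Mapping.keys (f i)) (n i)).
            total_exponent J (\<lambda>i. Poly_Mapping.keys (f i)) \<gamma> = E}.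
       \<Prod>i\<in>J. of_nat (multinomial (Poly_Mapping.keys (f i)) (\<gamma> i))
              * (\<Prod>a\<in>Poly_Mapping.keys (f i). Poly_Mapping.lookup (f i) a ^ \<gamma> i a))"
proof -
  let ?K = "\<lambda>i. Poly_Mapping.keys (f i)"
  let ?P = "Pi\<^sub>E J (\<lambda>i. compositions (?K i) (n i))"
  let ?c = "\<lambda>i \<gamma>. of_nat (multinomial (?K i) \<gamma>) * (\<Prod>a\<in>?K i. Poly_Mapping.lookup (f i) a ^ \<gamma> a)"
  let ?e = "\<lambda>i \<gamma>. \<Sum>a\<in>?K i. exponent_multiple (\<gamma> a) a"
  have finP: "finite ?P"
    using assms by (intro finite_PiE) (auto simp: finite_compositions)
  have one: "f i ^ n i = (\<Sum>\<gamma>\<in>compositions (?K i) (n i). Poly_Mapping.single (?e i \<gamma>) (?c i \<gamma>))" for i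
  proof -
    have "f i ^ n i = (\<Sum>a\<in>?K i. Poly_Mapping.single a (Poly_Mapping.lookup (f i) a)) ^ n i"
      by (simp flip: poly_mapping_sum_single)
    also have "\<dots> = (\<Sum>\<gamma>\<in>compositions (?K i) (n i). Poly_Mapping.single (?e i \<gamma>) (?c i \<gamma>))"
      by (simp add: multinomial_theorem single_power prod_single mult_single flip: single_of_nat)
    finally show ?thesis .
  qed
  have "(\<Prod>i\<in>J. f i ^ n i) = (\<Sum>\<gamma>\<in>?P. \<Prod>i\<in>J. Poly_Mapping.single (?e i (\<gamma> i)) (?c i (\<gamma> i)))"
    unfolding one by (rule prod_sum_PiE[OF assms]) (simp add: finite_compositions)
  also have "\<dots> = (\<Sum>\<gamma>\<in>?P. Poly_Mapping.single (total_exponent J ?K \<gamma>) (\<Prod>i\<in>J. ?c i (\<gamma> i)))"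
    by (simp add: prod_single total_exponent_def)
  finally have "Poly_Mapping.lookup (\<Prod>i\<in>J. f i ^ n i) E
      = (\<Sum>\<gamma>\<in>?P. if total_exponent J ?K \<gamma> = E then \<Prod>i\<in>J. ?c i (\<gamma> i) else 0)"
    by (simp add: lookup_sum lookup_single when_def)
  also have "\<dots> = (\<Sum>\<gamma>\<in>{\<gamma>\<in>?P. total_exponent J ?K \<gamma> = E}. \<Prod>i\<in>J. ?c i (\<gamma> i))"
    using finP by (simp add: sum.inter_filter)
  finally show ?thesis .
qed

section \<open>The unique maximal point of the splitting polytope\<close>

lemma hat_supp_eq:
  "hat_supp f i = Poly_Mapping.keys (f i) - (\<Union>j\<in>{1..<i}. Poly_Mapping.keys (f j))" (is "_ = ?D")
proof -
  have "finite ?D" by simp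
  hence lookup: "Poly_Mapping.lookup (hat f i) b = (if b \<in> ?D then Poly_Mapping.lookup (f i) b else 0)" for b
    by (simp add: hat_def lookup_sum lookup_single when_def)
  have "b \<in> hat_supp f i \<longleftrightarrow> b \<in> ?D" for b
    unfolding in_keys_iff[of b "hat f i"] lookup by (simp add: in_keys_iff)
  thus ?thesis by blast
qed

lemma finite_columns: "finite (columns t f)"
  by (simp add: columns_def)

lemma inj_on_snd_columns: "inj_on snd (columns t f)"
proof (rule inj_onI)
  fix c c' assume c: "c \<in> columns t f" "c' \<in> columns t f" "snd c = snd c'"
  obtain i a where ia: "c = (i, a)" by force
  with c(3) obtain j where ja: "c' = (j, a)" by (cases c') auto
  have "i = j"
  proof (rule linorder_cases[of i j])
    assume "i < j"
    with c ia ja show ?thesis by (auto simp: columns_def hat_supp_eq)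
  next
    assume "j < i"
    with c ia ja show ?thesis by (auto simp: columns_def hat_supp_eq)
  qed
  thus "c = c'" by (simp add: ia ja)
qed

text \<open>The column lies in the block of the first \<open>f j\<close> that contains the monomial.\<close>

lemma first_column:
  assumes "i \<in> {1..t}" "a \<in> Poly_Mapping.keys (f i)"
  obtains j where "(j, a) \<in> columns t f" "j \<le> i"
proof -
  let ?Q = "\<lambda>j. j \<in> {1..t} \<and> a \<in> Poly_Mapping.keys (f j)"
  define m where "m = (LEAST j. ?Q j)"
  have Qi: "?Q i" using assms by simp
  have Q: "?Q m" unfolding m_def by (rule LeastI[of ?Q, OF Qi])
  have "a \<notin> Poly_Mapping.keys (f k)" if "k \<in> {1..<m}" for k
  proof -
    have "\<not> ?Q k" using that unfolding m_def by (intro not_less_Least) simp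
    thus ?thesis using that Q by simp
  qed
  with Q have "(m, a) \<in> columns t f" by (simp add: columns_def hat_supp_eq)
  moreover have "m \<le> i" unfolding m_def by (rule Least_le[of ?Q, OF Qi])
  ultimately show thesis by (rule that)
qed

text \<open>A monomial occurring in several of the \<open>f i\<close> labels a single column, so a choice \<open>\<gamma>\<close> of
  monomials from the factors becomes a vector on the columns by adding over \<open>i\<close>. The weights
  \<open>w = 1\<close> and \<open>w a = lookup a r\<close> show that this preserves the total and the exponent.\<close>

lemma sum_columns_collapse:
  fixes \<gamma> :: "nat \<Rightarrow> ('m \<Rightarrow>\<^sub>0 nat) \<Rightarrow> nat"
  assumes "\<And>i a. i \<in> {1..t} \<Longrightarrow> a \<notin> Poly_Mapping.keys (f i) \<Longrightarrow> \<gamma> i a = 0"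
  shows "(\<Sum>c\<in>columns t f. (\<Sum>i\<in>{1..t}. \<gamma> i (snd c)) * w (snd c))
    = (\<Sum>i\<in>{1..t}. \<Sum>a\<in>Poly_Mapping.keys (f i). \<gamma> i a * w a)"
proof -
  let ?U = "\<Union>i\<in>{1..t}. Poly_Mapping.keys (f i)"
  have img: "snd ` columns t f = ?U"
  proof
    show "snd ` columns t f \<subseteq> ?U" by (auto simp: columns_def hat_supp_eq)
    show "?U \<subseteq> snd ` columns t f"
    proof
      fix a assume "a \<in> ?U"
      then obtain i where "i \<in> {1..t}" "a \<in> Poly_Mapping.keys (f i)" by blast
      then obtain j where "(j, a) \<in> columns t f" using first_column by blast
      thus "a \<in> snd ` columns t f" by force
    qed
  qed
  have "(\<Sum>c\<in>columns t f. (\<Sum>i\<in>{1..t}. \<gamma> i (snd c)) * w (snd c))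
      = (\<Sum>a\<in>?U. \<Sum>i\<in>{1..t}. \<gamma> i a * w a)"
    unfolding img[symmetric] by (simp add: sum.reindex[OF inj_on_snd_columns] sum_distrib_right)
  also have "\<dots> = (\<Sum>i\<in>{1..t}. \<Sum>a\<in>?U. \<gamma> i a * w a)" by (rule sum.swap)
  also have "\<dots> = (\<Sum>i\<in>{1..t}. \<Sum>a\<in>Poly_Mapping.keys (f i). \<gamma> i a * w a)"
    by (intro sum.cong[OF refl] sum.mono_neutral_right) (auto simp: assms)
  finally show ?thesis .
qed

lemma sum_column_supported:
  fixes \<alpha> :: "nat \<Rightarrow> ('m \<Rightarrow>\<^sub>0 nat) \<Rightarrow> nat"
  assumes \<alpha>: "\<And>i a. i \<in> {1..t} \<Longrightarrow> a \<notin> hat_supp f i \<Longrightarrow> \<alpha> i a = 0"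
    and c: "(j, a) \<in> columns t f"
  shows "(\<Sum>i\<in>{1..t}. \<alpha> i a) = \<alpha> j a"
proof -
  have "\<alpha> i a = 0" if "i \<in> {1..t} - {j}" for i
  proof (rule ccontr)
    assume "\<alpha> i a \<noteq> 0"
    hence "(i, a) \<in> columns t f" using \<alpha>[of i a] that by (auto simp: columns_def)
    hence "(i, a) = (j, a)" by (rule inj_onD[OF inj_on_snd_columns _ _ c, rotated]) simp
    thus False using that by simp
  qed
  thus ?thesis using c by (subst sum.remove[of _ j]) (auto simp: columns_def)
qed

text \<open>Collapse \<open>\<gamma>\<close> and \<open>\<alpha>\<close> to vectors on the columns and move \<open>\<rho>\<close> by their difference divided by
  \<open>q\<close>. The result \<open>\<sigma>\<close> stays in the polytope, as the exponents agree and \<open>\<alpha> / q\<close> is below \<open>\<rho>\<close>, and it has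
  the same total, so it equals \<open>\<rho>\<close> and the collapsed vectors agree. To recover \<open>\<gamma>\<close> itself,
  argue by induction on the block \<open>i\<close>: a monomial of \<open>f i\<close> whose column belongs to an earlier
  block is already used up there, so \<open>\<gamma> i\<close> is at most \<open>\<alpha> i\<close>, and the two have equal sums.\<close>

lemma unique_preimage_of_exponent:
  fixes f :: "nat \<Rightarrow> ('m, 'k::comm_ring_1) mpoly" and \<alpha> \<gamma> :: "nat \<Rightarrow> ('m \<Rightarrow>\<^sub>0 nat) \<Rightarrow> nat"
  assumes max: "maximal_point t f \<rho>" and unique: "\<And>\<sigma>. maximal_point t f \<sigma> \<Longrightarrow> \<sigma> = \<rho>"
    and q: "q > 0"
    and \<alpha>_supp: "\<And>i a. i \<in> {1..t} \<Longrightarrow> a \<notin> hat_supp f i \<Longrightarrow> \<alpha> i a = 0"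
    and \<alpha>_le: "\<And>i a. (i, a) \<in> columns t f \<Longrightarrow> real (\<alpha> i a) \<le> \<rho> (i, a) * q"
    and \<gamma>_supp: "\<And>i a. i \<in> {1..t} \<Longrightarrow> a \<notin> Poly_Mapping.keys (f i) \<Longrightarrow> \<gamma> i a = 0"
    and sums: "\<And>i. i \<in> {1..t} \<Longrightarrow> sum (\<gamma> i) (Poly_Mapping.keys (f i)) = sum (\<alpha> i) (Poly_Mapping.keys (f i))"
    and exps: "total_exponent {1..t} (\<lambda>i. Poly_Mapping.keys (f i)) \<gamma>
             = total_exponent {1..t} (\<lambda>i. Poly_Mapping.keys (f i)) \<alpha>"
    and i: "i \<in> {1..t}"
  shows "\<gamma> i = \<alpha> i"
proof -
  let ?C = "columns t f" and ?K = "\<lambda>i. Poly_Mapping.keys (f i)"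
  let ?coll = "\<lambda>\<gamma> :: nat \<Rightarrow> ('m \<Rightarrow>\<^sub>0 nat) \<Rightarrow> nat. \<lambda>c :: nat \<times> ('m \<Rightarrow>\<^sub>0 nat). \<Sum>i\<in>{1..t}. \<gamma> i (snd c)"
  define \<sigma> where "\<sigma> = (\<lambda>c\<in>?C. \<rho> c + (real (?coll \<gamma> c) - real (?coll \<alpha> c)) / q)"
  have \<alpha>_supp': "\<alpha> i a = 0" if "i \<in> {1..t}" "a \<notin> ?K i" for i a
    using \<alpha>_supp that by (auto simp: hat_supp_eq)
  have \<rho>: "\<rho> \<in> splitting_polytope t f" using max by (simp add: maximal_point_def is_arg_max_def)
  have same: "(\<Sum>c\<in>?C. ?coll \<gamma> c * w (snd c)) = (\<Sum>c\<in>?C. ?coll \<alpha> c * w (snd c))"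
    if "(\<Sum>i\<in>{1..t}. \<Sum>a\<in>?K i. \<gamma> i a * w a) = (\<Sum>i\<in>{1..t}. \<Sum>a\<in>?K i. \<alpha> i a * w a)" for w
    using that sum_columns_collapse[of t f \<gamma> w] sum_columns_collapse[of t f \<alpha> w] \<gamma>_supp \<alpha>_supp'
    by simp
  have weighted: "(\<Sum>c\<in>?C. real (w (snd c)) * \<sigma> c) = (\<Sum>c\<in>?C. real (w (snd c)) * \<rho> c)"
    if "(\<Sum>c\<in>?C. ?coll \<gamma> c * w (snd c)) = (\<Sum>c\<in>?C. ?coll \<alpha> c * w (snd c))" for w
  proof -
    have "(\<Sum>c\<in>?C. real (w (snd c)) * \<sigma> c) = (\<Sum>c\<in>?C. real (w (snd c)) * \<rho> c
        + (real (?coll \<gamma> c * w (snd c)) - real (?coll \<alpha> c * w (snd c))) / q)"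
      by (intro sum.cong) (simp_all add: \<sigma>_def diff_divide_distrib algebra_simps)
    also have "\<dots> = (\<Sum>c\<in>?C. real (w (snd c)) * \<rho> c)
        + (real (\<Sum>c\<in>?C. ?coll \<gamma> c * w (snd c)) - real (\<Sum>c\<in>?C. ?coll \<alpha> c * w (snd c))) / q"
      by (simp only: sum.distrib sum_subtractf of_nat_sum flip: sum_divide_distrib)
    finally show ?thesis by (simp only: that) simp
  qed
  have eq_sum: "(\<Sum>c\<in>?C. \<sigma> c) = (\<Sum>c\<in>?C. \<rho> c)"
    using weighted[of "\<lambda>_. 1"] same[of "\<lambda>_. 1"] sums by simp
  have eq_row: "(\<Sum>c\<in>?C. real (exponent_matrix r c) * \<sigma> c) = (\<Sum>c\<in>?C. real (exponent_matrix r c) * \<rho> c)" for r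
    using weighted[of "\<lambda>a. Poly_Mapping.lookup a r"] same[of "\<lambda>a. Poly_Mapping.lookup a r"]
      arg_cong[OF exps, of "\<lambda>E. Poly_Mapping.lookup E r"]
    by (simp add: lookup_total_exponent exponent_matrix_def)
  have coll_\<alpha>: "?coll \<alpha> c = \<alpha> (fst c) (snd c)" if "c \<in> ?C" for c
    using sum_column_supported[of t f \<alpha> "fst c" "snd c"] \<alpha>_supp that by simp
  have "0 \<le> \<sigma> c" if "c \<in> ?C" for c
  proof -
    have "real (?coll \<alpha> c) / q \<le> \<rho> c"
      using \<alpha>_le[of "fst c" "snd c"] that q coll_\<alpha>[OF that] by (simp add: pos_divide_le_eq)
    moreover have "0 \<le> real (?coll \<gamma> c) / q" using q by (intro divide_nonneg_pos of_nat_0_le_iff)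
    ultimately show ?thesis using that by (simp add: \<sigma>_def diff_divide_distrib)
  qed
  hence "\<sigma> \<in> splitting_polytope t f"
    using \<rho> eq_row by (auto simp: splitting_polytope_def \<sigma>_def)
  hence "maximal_point t f \<sigma>"
    using max by (simp add: maximal_point_def is_arg_max_def eq_sum)
  hence "\<sigma> = \<rho>" by (rule unique)
  have coll: "(\<Sum>i\<in>{1..t}. \<gamma> i a) = \<alpha> j a" if "(j, a) \<in> ?C" for j a
  proof -
    have "\<sigma> (j, a) = \<rho> (j, a)" by (simp add: \<open>\<sigma> = \<rho>\<close>)
    hence "real (?coll \<gamma> (j, a)) = real (?coll \<alpha> (j, a))" using that q by (simp add: \<sigma>_def)
    thus ?thesis using coll_\<alpha>[OF that] by (simp only: of_nat_eq_iff) simp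
  qed
  show ?thesis using i
  proof (induction i rule: less_induct)
    case (less i)
    have le: "\<gamma> i a \<le> \<alpha> i a" if a: "a \<in> ?K i" for a
    proof -
      obtain j where j: "(j, a) \<in> ?C" "j \<le> i" using less.prems a by (rule first_column)
      hence jt: "j \<in> {1..t}" by (auto simp: columns_def)
      show ?thesis
      proof (cases "j = i")
        case True
        have "\<gamma> i a \<le> (\<Sum>i\<in>{1..t}. \<gamma> i a)" using less.prems by (intro member_le_sum) auto
        thus ?thesis using coll[OF j(1)] True by simp
      next
        case False
        hence "\<gamma> j = \<alpha> j" using less.IH[of j] j(2) jt by simp
        have "\<gamma> j a + \<gamma> i a = (\<Sum>i\<in>{j, i}. \<gamma> i a)" using False by simp
        also have "\<dots> \<le> (\<Sum>i\<in>{1..t}. \<gamma> i a)" using less.prems jt by (intro sum_mono2) auto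
        also have "\<dots> = \<gamma> j a" using coll[OF j(1)] \<open>\<gamma> j = \<alpha> j\<close> by simp
        finally show ?thesis by simp
      qed
    qed
    show ?case
    proof
      fix a show "\<gamma> i a = \<alpha> i a"
      proof (cases "a \<in> ?K i")
        case True
        show ?thesis by (rule sum_mono_inv[OF sums[OF less.prems] le True finite_keys])
      next
        case False
        thus ?thesis using \<gamma>_supp[OF less.prems False] \<alpha>_supp'[OF less.prems False] by simp
      qed
    qed
  qed
qed

section \<open>Exponents outside the Frobenius power\<close>

text \<open>The product of the powers contains the monomial whose exponent is the image of \<open>\<alpha>\<close> under
  the exponent matrix: only \<open>\<alpha>\<close> contributes to its coefficient, and this contribution is
  nonzero because no carries occur. All its exponents are smaller than \<open>p ^ e\<close>.\<close>

lemma carry_free_exponents_in_V_set: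
  fixes f :: "nat \<Rightarrow> ('m::finite, 'k::field) mpoly"
  assumes p: "prime p" "CHAR('k) = p"
    and max: "maximal_point t f \<rho>" and unique: "\<And>\<sigma>. maximal_point t f \<sigma> \<Longrightarrow> \<sigma> = \<rho>"
    and \<delta>: "\<And>i. i \<in> {1..t} \<Longrightarrow> carry_free_below p (hat_supp f i) (\<lambda>a. \<rho> (i, a)) (\<delta> i)"
  shows "(\<lambda>i\<in>{1..t}. \<Sum>a\<in>hat_supp f i. digits_value p (\<delta> i a) e)
    \<in> V_set t (\<lambda>i. ideal_gen {f i}) irrelevant_ideal (p ^ e)"
proof -
  let ?C = "columns t f" and ?K = "\<lambda>i. Poly_Mapping.keys (f i)"
  have p0: "p > 0" using p(1) prime_gt_0_nat by blast
  have \<rho>: "\<rho> \<in> splitting_polytope t f" using max by (simp add: maximal_point_def is_arg_max_def)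
  \<comment> \<open>Monomials of \<open>f i\<close> that belong to an earlier block get the exponent 0.\<close>
  define \<delta>' where "\<delta>' i a k = (if a \<in> hat_supp f i then \<delta> i a k else 0)" for i a k
  define \<alpha> where "\<alpha> i a = digits_value p (\<delta>' i a) e" for i a
  define n where "n i = sum (\<alpha> i) (?K i)" for i
  define E where "E = total_exponent {1..t} ?K \<alpha>"
  have sub: "hat_supp f i \<subseteq> ?K i" for i by (auto simp: hat_supp_eq)
  have \<alpha>_hat: "\<alpha> i a = digits_value p (\<delta> i a) e" if "a \<in> hat_supp f i" for i a
    using that by (simp add: \<alpha>_def \<delta>'_def cong: digits_value_cong)
  have \<alpha>_supp: "\<alpha> i a = 0" if "a \<notin> hat_supp f i" for i a
    using that by (simp add: \<alpha>_def \<delta>'_def digits_value_eq_0)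
  have n_eq: "n i = (\<Sum>a\<in>hat_supp f i. digits_value p (\<delta> i a) e)" for i
  proof -
    have "n i = sum (\<alpha> i) (hat_supp f i)"
      unfolding n_def using sub \<alpha>_supp by (intro sum.mono_neutral_right) auto
    thus ?thesis by (simp add: \<alpha>_hat)
  qed
  have below: "if \<rho> (i, a) = 0 then \<alpha> i a = 0 else real (\<alpha> i a) < \<rho> (i, a) * real p ^ e"
    if "(i, a) \<in> ?C" for i a
    using \<delta>[of i] that \<alpha>_hat[of a i] by (auto simp: carry_free_below_def columns_def)
  hence le: "real (\<alpha> i a) \<le> \<rho> (i, a) * real p ^ e" if "(i, a) \<in> ?C" for i a
    using that by (force split: if_splits)
  have nc: "(\<Sum>a\<in>?K i. \<delta>' i a k) \<le> p - 1" if "i \<in> {1..t}" for i k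
  proof -
    have "(\<Sum>a\<in>?K i. \<delta>' i a k) = (\<Sum>a\<in>hat_supp f i. \<delta>' i a k)"
      using sub by (intro sum.mono_neutral_right) (auto simp: \<delta>'_def)
    also have "\<dots> = (\<Sum>a\<in>hat_supp f i. \<delta> i a k)" by (simp add: \<delta>'_def)
    also have "\<dots> \<le> p - 1" using \<delta>[OF that] by (simp add: carry_free_below_def)
    finally show ?thesis .
  qed
  have singleton: "{\<gamma>\<in>Pi\<^sub>E {1..t} (\<lambda>i. compositions (?K i) (n i)). total_exponent {1..t} ?K \<gamma> = E}
      = {restrict \<alpha> {1..t}}" (is "?L = _")
  proof (intro equalityI subsetI)
    fix \<gamma> assume \<gamma>: "\<gamma> \<in> ?L"
    hence comp: "\<gamma> i \<in> compositions (?K i) (n i)" if "i \<in> {1..t}" for i using that by auto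
    have "\<gamma> i = \<alpha> i" if "i \<in> {1..t}" for i
    proof (rule unique_preimage_of_exponent[OF max unique])
      show "real p ^ e > 0" using p0 by simp
      show "total_exponent {1..t} ?K \<gamma> = total_exponent {1..t} ?K \<alpha>" using \<gamma> by (simp add: E_def)
      show "sum (\<gamma> i) (?K i) = sum (\<alpha> i) (?K i)" if "i \<in> {1..t}" for i
        using comp[OF that] by (simp add: compositions_def n_def)
      show "\<gamma> i a = 0" if "i \<in> {1..t}" "a \<notin> ?K i" for i a
        using comp[OF that(1)] that(2) by (simp add: compositions_def)
    qed (use le \<alpha>_supp that in auto)
    thus "\<gamma> \<in> {restrict \<alpha> {1..t}}" using \<gamma> by (auto simp: PiE_def extensional_def fun_eq_iff)
  next
    fix \<gamma> assume "\<gamma> \<in> {restrict \<alpha> {1..t}}"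
    moreover have "\<alpha> i \<in> compositions (?K i) (n i)" for i
      using \<alpha>_supp sub by (auto simp: compositions_def n_def)
    moreover have "total_exponent {1..t} ?K (restrict \<alpha> {1..t}) = E"
      unfolding E_def total_exponent_def by (intro sum.cong) auto
    ultimately show "\<gamma> \<in> ?L" by auto
  qed
  have "Poly_Mapping.lookup (\<Prod>i\<in>{1..t}. f i ^ n i) E
      = (\<Prod>i\<in>{1..t}. of_nat (multinomial (?K i) (\<alpha> i)) * (\<Prod>a\<in>?K i. Poly_Mapping.lookup (f i) a ^ \<alpha> i a))"
    unfolding lookup_prod_power[OF finite_atLeastAtMost] singleton by simp
  also have "\<dots> \<noteq> 0"
  proof -
    have "of_nat (multinomial (?K i) (\<alpha> i)) \<noteq> (0 :: 'k)" if "i \<in> {1..t}" for i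
    proof -
      have "\<alpha> i = (\<lambda>a. digits_value p (\<delta>' i a) e)" by (simp add: \<alpha>_def fun_eq_iff)
      moreover have "\<not> p dvd multinomial (?K i) (\<lambda>a. digits_value p (\<delta>' i a) e)"
        by (rule not_dvd_multinomial_carry_free[OF p(1) finite_keys nc[OF that]])
      ultimately show ?thesis using p(2) by (simp add: of_nat_eq_0_iff_char_dvd)
    qed
    thus ?thesis by (auto simp: prod_zero_iff in_keys_iff)
  qed
  finally have key: "E \<in> Poly_Mapping.keys (\<Prod>i\<in>{1..t}. f i ^ n i)" by (simp add: in_keys_iff)
  have small: "Poly_Mapping.lookup E r < p ^ e" for r
  proof -
    let ?x = "\<lambda>c. real (exponent_matrix r c)"
    have "Poly_Mapping.lookup E r = (\<Sum>c\<in>?C. (\<Sum>i\<in>{1..t}. \<alpha> i (snd c)) * Poly_Mapping.lookup (snd c) r)"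
      unfolding E_def lookup_total_exponent
      using sub \<alpha>_supp by (intro sum_columns_collapse[symmetric]) auto
    also have "\<dots> = (\<Sum>c\<in>?C. \<alpha> (fst c) (snd c) * Poly_Mapping.lookup (snd c) r)"
      using sum_column_supported[of t f \<alpha>] \<alpha>_supp by (intro sum.cong) auto
    finally have eq: "real (Poly_Mapping.lookup E r) = (\<Sum>c\<in>?C. ?x c * real (\<alpha> (fst c) (snd c)))"
      by (simp add: exponent_matrix_def mult.commute)
    have "real (Poly_Mapping.lookup E r) < real p ^ e"
    \<comment> \<open>If a column with \<open>\<rho> c > 0\<close> involves \<open>x\<^sub>r\<close>, strictness there makes the row sum strict;
      otherwise \<open>x\<^sub>r\<close> does not occur in the monomial at all.\<close>
    proof (cases "\<exists>c\<in>?C. exponent_matrix r c \<noteq> 0 \<and> \<rho> c \<noteq> 0")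
      case True
      have "real (Poly_Mapping.lookup E r) < (\<Sum>c\<in>?C. ?x c * (\<rho> c * real p ^ e))"
        unfolding eq
      proof (rule sum_strict_mono_ex1[OF finite_columns])
        show "\<forall>c\<in>?C. ?x c * real (\<alpha> (fst c) (snd c)) \<le> ?x c * (\<rho> c * real p ^ e)"
          using le by (auto intro!: mult_left_mono)
        obtain c where c: "c \<in> ?C" "exponent_matrix r c \<noteq> 0" "\<rho> c \<noteq> 0" using True by blast
        hence "?x c * real (\<alpha> (fst c) (snd c)) < ?x c * (\<rho> c * real p ^ e)"
          using below[of "fst c" "snd c"] by simp
        thus "\<exists>c\<in>?C. ?x c * real (\<alpha> (fst c) (snd c)) < ?x c * (\<rho> c * real p ^ e)" using c(1) by blast
      qed
      also have "\<dots> = (\<Sum>c\<in>?C. ?x c * \<rho> c) * real p ^ e"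
        by (simp add: sum_distrib_right mult.assoc)
      also have "\<dots> \<le> 1 * real p ^ e"
        using \<rho> p0 by (intro mult_right_mono) (auto simp: splitting_polytope_def)
      finally show ?thesis by simp
    next
      case False
      have "(\<Sum>c\<in>?C. ?x c * real (\<alpha> (fst c) (snd c))) = 0"
      proof (intro sum.neutral ballI)
        fix c assume "c \<in> ?C"
        thus "?x c * real (\<alpha> (fst c) (snd c)) = 0"
          using False below[of "fst c" "snd c"] by auto
      qed
      thus ?thesis using eq p0 by simp
    qed
    thus ?thesis by (metis of_nat_less_iff of_nat_power)
  qed
  have "(\<Prod>i\<in>{1..t}. f i ^ n i) \<notin> high_degree (p ^ e)"
    using key small by (auto simp: high_degree_def not_le intro!: bexI[of _ E])
  hence "(\<Prod>i\<in>{1..t}. f i ^ n i) \<notin> frobenius_power irrelevant_ideal (p ^ e)"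
    using frobenius_power_irrelevant_subset[where 'k = 'k, of "p ^ e" e] p by blast
  moreover have "(\<Prod>i\<in>{1..t}. f i ^ restrict n {1..t} i) = (\<Prod>i\<in>{1..t}. f i ^ n i)"
    by (rule prod.cong) auto
  ultimately show ?thesis unfolding V_set_principal n_eq[symmetric] by simp
qed

section \<open>The lower bound\<close>

text \<open>Together with \<open>Q 0\<close>, a finite supremum is attained and \<open>Suc s\<close> is the first failure of \<open>Q\<close>;
  an infinite one means that \<open>Q\<close> never fails.\<close>

lemma Sup_enat_prefix:
  assumes S: "S = Sup {enat l | l. \<forall>k\<le>l. Q k}" and "Q 0"
  shows "S = \<infinity> \<Longrightarrow> Q k" and "S = enat s \<Longrightarrow> (\<forall>k\<le>s. Q k) \<and> \<not> Q (Suc s)"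
proof -
  have bound: "S \<le> enat (k - 1)" if "\<not> Q k" for k
    unfolding S
  proof (rule Sup_least)
    fix x assume "x \<in> {enat l | l. \<forall>k\<le>l. Q k}"
    then obtain l where l: "x = enat l" "\<forall>k\<le>l. Q k" by blast
    with that have "l < k" by (meson not_le)
    thus "x \<le> enat (k - 1)" using l(1) by simp
  qed
  show "Q k" if "S = \<infinity>"
    using bound[of k] that by auto
  show "(\<forall>k\<le>s. Q k) \<and> \<not> Q (Suc s)" if s: "S = enat s"
  proof
    show pre: "\<forall>k\<le>s. Q k"
    proof (intro allI impI, rule ccontr)
      fix k assume "k \<le> s" "\<not> Q k"
      moreover from this have "k \<noteq> 0" using \<open>Q 0\<close> by metis
      ultimately show False using bound[of k] s by simp
    qed
    show "\<not> Q (Suc s)"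
    proof
      assume "Q (Suc s)"
      hence "enat (Suc s) \<in> {enat l | l. \<forall>k\<le>l. Q k}" using pre by (auto simp: le_Suc_eq)
      hence "enat (Suc s) \<le> S" unfolding S by (rule Sup_upper)
      thus False using s by simp
    qed
  qed
qed

theorem theorem3:
  fixes p t :: nat
    and f :: "nat \<Rightarrow> ('m::finite, 'k::field) mpoly"
    and \<rho> :: "nat \<times> ('m \<Rightarrow>\<^sub>0 nat) \<Rightarrow> real"
    and S :: "nat \<Rightarrow> enat"
    and I :: "nat set"
  assumes p: "prime p" "CHAR('k) = p"
    and F_finite: "F_finite TYPE(('m, 'k) mpoly)"
    and f: "\<And>i. i \<in> {1..t} \<Longrightarrow> f i \<in> irrelevant_ideal"
    and \<rho>_max: "maximal_point t f \<rho>"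
    and \<rho>_unique: "\<And>\<gamma>. maximal_point t f \<gamma> \<Longrightarrow> \<gamma> = \<rho>"
    and S: "\<And>i. i \<in> {1..t} \<Longrightarrow>
      S i = Sup {enat l | l. \<forall>e\<le>l. (\<Sum>a\<in>hat_supp f i. digit p (\<rho> (i, a)) e) \<le> p - 1}"
    and I: "I = {i \<in> {1..t}. S i \<noteq> \<infinity>}"
  shows "(\<Prod>i\<in>I. (\<Sum>a\<in>hat_supp f i. truncation p (the_enat (S i)) (\<rho> (i, a)))
                   + 1 / real p ^ the_enat (S i))
         * (\<Prod>i\<in>{1..t} - I. \<Sum>a\<in>hat_supp f i. \<rho> (i, a))
       \<le> F_volume p t (\<lambda>i. ideal_gen {f i}) irrelevant_ideal"
proof -
  let ?V = "\<lambda>e. V_set t (\<lambda>i. ideal_gen {f i}) irrelevant_ideal (p ^ e)"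
  have p2: "p \<ge> 2" using p(1) prime_ge_2_nat by blast
  have pR: "prime CHAR(('m, 'k) mpoly)" "p = CHAR(('m, 'k) mpoly)"
    using p by (simp_all add: CHAR_poly_mapping)
  define T where "T i = (if i \<in> I then (\<Sum>a\<in>hat_supp f i. truncation p (the_enat (S i)) (\<rho> (i, a)))
                   + 1 / real p ^ the_enat (S i) else \<Sum>a\<in>hat_supp f i. \<rho> (i, a))" for i
  have \<rho>: "\<rho> \<in> splitting_polytope t f" using \<rho>_max by (simp add: maximal_point_def is_arg_max_def)
  have unit: "0 \<le> \<rho> (i, a) \<and> \<rho> (i, a) \<le> 1" if i: "i \<in> {1..t}" and a: "a \<in> hat_supp f i" for i a
  proof
    have c: "(i, a) \<in> columns t f" using i a by (simp add: columns_def)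
    have nonneg: "0 \<le> \<rho> c" if "c \<in> columns t f" for c
      using \<rho> that by (auto simp: splitting_polytope_def)
    show "0 \<le> \<rho> (i, a)" using nonneg[OF c] .
    have "a \<noteq> 0" using irrelevant_ideal_no_constant[OF f[OF i]] a by (auto simp: hat_supp_eq)
    then obtain r where "Poly_Mapping.lookup a r \<noteq> 0" by (metis poly_mapping_eqI lookup_zero)
    hence "1 * \<rho> (i, a) \<le> real (exponent_matrix r (i, a)) * \<rho> (i, a)"
      using nonneg[OF c] by (intro mult_right_mono) (auto simp: exponent_matrix_def)
    also have "\<dots> \<le> (\<Sum>c\<in>columns t f. real (exponent_matrix r c) * \<rho> c)"
      using nonneg by (intro member_le_sum[OF c _ finite_columns]) auto
    also have "\<dots> \<le> 1" using \<rho> by (simp add: splitting_polytope_def)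
    finally show "\<rho> (i, a) \<le> 1" by simp
  qed
  have digit0: "(\<Sum>a\<in>hat_supp f i. digit p (\<rho> (i, a)) 0) \<le> p - 1" if i: "i \<in> {1..t}" for i
  proof -
    have "digit p (\<rho> (i, a)) 0 = 0" if "a \<in> hat_supp f i" for a
      using unit[OF i that] nonterminating_expansion_digit[OF p2, of "\<rho> (i, a)"]
      by (cases "\<rho> (i, a) = 0") (auto simp: nonterminating_expansion_def)
    thus ?thesis by simp
  qed
  have "\<exists>\<delta>. carry_free_below p (hat_supp f i) (\<lambda>a. \<rho> (i, a)) \<delta> \<and>
      (\<lambda>e. real ((\<Sum>a\<in>hat_supp f i. digits_value p (\<delta> a) e) + 1) / real p ^ e) \<longlonglongrightarrow> T i"
    if i: "i \<in> {1..t}" for i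
  proof (cases "S i")
    case (enat s)
    hence T: "T i = (\<Sum>a\<in>hat_supp f i. truncation p s (\<rho> (i, a))) + 1 / real p ^ s"
      using i by (simp add: T_def I)
    note prefix = Sup_enat_prefix(2)[OF S[OF i] digit0[OF i] enat]
    show ?thesis unfolding T
      by (rule carry_free_below_at_carry[OF p2, of "hat_supp f i" "\<lambda>a. \<rho> (i, a)" s])
        (use unit[OF i] prefix in auto)
  next
    case infinity
    hence "T i = (\<Sum>a\<in>hat_supp f i. \<rho> (i, a))" by (simp add: T_def I)
    moreover note Sup_enat_prefix(1)[OF S[OF i] digit0[OF i] infinity]
    ultimately show ?thesis
      using carry_free_below_digit[OF p2, of "hat_supp f i" "\<lambda>a. \<rho> (i, a)"] unit[OF i] by auto
  qed
  hence "\<forall>i\<in>{1..t}. \<exists>\<delta>. carry_free_below p (hat_supp f i) (\<lambda>a. \<rho> (i, a)) \<delta> \<and>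
      (\<lambda>e. real ((\<Sum>a\<in>hat_supp f i. digits_value p (\<delta> a) e) + 1) / real p ^ e) \<longlonglongrightarrow> T i"
    by (intro ballI)
  from bchoice[OF this] obtain \<delta> where
    both: "\<forall>i\<in>{1..t}. carry_free_below p (hat_supp f i) (\<lambda>a. \<rho> (i, a)) (\<delta> i) \<and>
      (\<lambda>e. real ((\<Sum>a\<in>hat_supp f i. digits_value p (\<delta> i a) e) + 1) / real p ^ e) \<longlonglongrightarrow> T i" ..
  note \<delta> = conjunct1[OF bspec[OF both]] and \<delta>_lim = conjunct2[OF bspec[OF both]]
  define n where "n e i = (\<Sum>a\<in>hat_supp f i. digits_value p (\<delta> i a) e)" for e i
  have "(\<Prod>i\<in>{1..t}. T i) \<le> F_volume p t (\<lambda>i. ideal_gen {f i}) irrelevant_ideal"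
  proof (rule F_volume_principal_ge[OF pR f])
    show "(\<lambda>e. \<Prod>i\<in>{1..t}. real (n e i + 1) / real p ^ e) \<longlonglongrightarrow> (\<Prod>i\<in>{1..t}. T i)"
      unfolding n_def by (intro tendsto_prod \<delta>_lim)
    fix e
    have mem: "(\<lambda>i\<in>{1..t}. n e i) \<in> ?V e"
      unfolding n_def by (rule carry_free_exponents_in_V_set[OF p \<rho>_max \<rho>_unique \<delta>])
    \<comment> \<open>\<open>V_set\<close> is closed under decreasing the exponents, as divisors of a product outside an
      ideal are outside it as well.\<close>
    have "Pi\<^sub>E {1..t} (\<lambda>i. {..n e i}) \<subseteq> ?V e"
    proof
      fix n' assume n': "n' \<in> Pi\<^sub>E {1..t} (\<lambda>i. {..n e i})"
      have "(\<Prod>i\<in>{1..t}. f i ^ n' i) \<notin> frobenius_power irrelevant_ideal (p ^ e)"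
      proof
        assume "(\<Prod>i\<in>{1..t}. f i ^ n' i) \<in> frobenius_power irrelevant_ideal (p ^ e)"
        hence "(\<Prod>i\<in>{1..t}. f i ^ (\<lambda>i\<in>{1..t}. n e i) i) \<in> frobenius_power irrelevant_ideal (p ^ e)"
          by (rule prod_power_in_frobenius_power_mono) (use n' in auto)
        with mem show False by (simp add: V_set_principal)
      qed
      thus "n' \<in> ?V e" using n' by (auto simp: V_set_principal PiE_def)
    qed
    hence "card (Pi\<^sub>E {1..t} (\<lambda>i. {..n e i})) \<le> card (?V e)"
      by (intro card_mono finite_V_set[OF pR] f)
    hence "(\<Prod>i\<in>{1..t}. n e i + 1) \<le> card (?V e)" by (simp add: card_PiE)
    hence "real (\<Prod>i\<in>{1..t}. n e i + 1) / real p ^ (e * t) \<le> real (card (?V e)) / real p ^ (e * t)"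
      by (intro divide_right_mono of_nat_mono) simp_all
    thus "(\<Prod>i\<in>{1..t}. real (n e i + 1) / real p ^ e) \<le> real (card (?V e)) / real p ^ (e * t)"
      by (simp add: prod_dividef power_mult)
  qed
  moreover have "(\<Prod>i\<in>{1..t}. T i) = (\<Prod>i\<in>I. T i) * (\<Prod>i\<in>{1..t} - I. T i)"
    using I by (subst prod.subset_diff[of I "{1..t}"]) (auto simp: mult.commute)
  ultimately show ?thesis by (simp add: T_def)
qed

end
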